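(* Let $\mathcal H_1$ be the $3$-dimensional discrete Heisenberg group (the group of $3\times3$ upper unitriangular matrices with integer entries), and let $S$ be any finite symmetric generating set of $\mathcal H_1$. Then the horofunction boundary $\partial(\mathcal H_1,S)$ has the cardinality of the continuum.
   Context: Let $G$ be a group with finite symmetric generating set $S$ and word metric $d_S$. For $g\in G$ put $\varphi_g(\ast)=d_S(g,\ast)-d_S(g,e)$, and $\iota(g)=\varphi_g$, in the space of functions $G\to\mathbb R$ with the topology of pointwise convergence. The horofunction boundary is $\partial(G,S)=\overline{\iota(G)}\setminus\iota(G)$. *)

theory Defs
  imports "HOL-Analysis.Analysis" "HOL-Algebra.Generated_Groups" "HOL-Library.Equipollence"
begin

(* The rows and columns of an int^3^3 matrix are numbered 1, 2, 3, as in the library.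
   The entries are listed because the linear order on the index type 3 puts 3 (= 0) first. *)
definition heisenberg :: "(int^3^3) monoid" where
  "heisenberg = \<lparr>
     carrier = {A. A$1$1 = 1 \<and> A$2$2 = 1 \<and> A$3$3 = 1 \<and> A$2$1 = 0 \<and> A$3$1 = 0 \<and> A$3$2 = 0},
     mult = (**), one = mat 1\<rparr>"

lemma group_heisenberg: "group heisenberg"
proof (rule groupI)
  fix A assume A: "A \<in> carrier heisenberg"
  define B :: "int^3^3" where
    "B = vector [vector [1, - A$1$2, A$1$2 * A$2$3 - A$1$3], vector [0, 1, - A$2$3], vector [0, 0, 1]]"
  have "B \<in> carrier heisenberg"
    by (simp add: heisenberg_def B_def)
  moreover have "B ** A = mat 1"
    using A by (simp add: heisenberg_def B_def vec_eq_iff forall_3 matrix_matrix_mult_def sum_3 mat_def)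
  ultimately show "\<exists>B\<in>carrier heisenberg. B \<otimes>\<^bsub>heisenberg\<^esub> A = \<one>\<^bsub>heisenberg\<^esub>"
    by (auto simp: heisenberg_def)
qed (auto simp: heisenberg_def matrix_matrix_mult_def sum_3 mat_def matrix_mul_assoc[unfolded matrix_matrix_mult_def sum_3]
       vec_eq_iff forall_3 algebra_simps)

definition symmetric_generating_set :: "('a, 'b) monoid_scheme \<Rightarrow> 'a set \<Rightarrow> bool" where
  "symmetric_generating_set G S \<longleftrightarrow>
     S \<subseteq> carrier G \<and> (\<forall>s\<in>S. inv\<^bsub>G\<^esub> s \<in> S) \<and> generate G S = carrier G"

(* Only meaningful if every element of G is a product of elements of S; this holds for
   symmetric generating sets. *)
definition word_length :: "('a, 'b) monoid_scheme \<Rightarrow> 'a set \<Rightarrow> 'a \<Rightarrow> nat" where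
  "word_length G S g =
     (LEAST n. \<exists>ws. length ws = n \<and> set ws \<subseteq> S \<and> foldr (mult G) ws \<one>\<^bsub>G\<^esub> = g)"

definition word_metric :: "('a, 'b) monoid_scheme \<Rightarrow> 'a set \<Rightarrow> 'a \<Rightarrow> 'a \<Rightarrow> nat" where
  "word_metric G S g h = word_length G S (inv\<^bsub>G\<^esub> g \<otimes>\<^bsub>G\<^esub> h)"

(* Functions on G are extensional functions on the carrier, i.e. the points of the
   product topology below. *)
definition horo_embedding :: "('a, 'b) monoid_scheme \<Rightarrow> 'a set \<Rightarrow> 'a \<Rightarrow> 'a \<Rightarrow> real" where
  "horo_embedding G S g =
     (\<lambda>x\<in>carrier G. real (word_metric G S g x) - real (word_metric G S g \<one>\<^bsub>G\<^esub>))"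

definition horofunction_boundary :: "('a, 'b) monoid_scheme \<Rightarrow> 'a set \<Rightarrow> ('a \<Rightarrow> real) set" where
  "horofunction_boundary G S =
     (product_topology (\<lambda>_. euclideanreal) (carrier G)
        closure_of (horo_embedding G S ` carrier G))
     - horo_embedding G S ` carrier G"

end

theory Submission
  imports Defs
begin

text \<open>
  Idea. Let \<open>a\<close> be a letter whose image in the abelianization \<open>\<int>\<^sup>2\<close> has maximal Euclidean norm, and
  \<open>b\<close> a letter whose image is not parallel to it. For large \<open>i\<close> fix a central element \<open>z\<^sub>i\<close> of area
  of order \<open>i\<^sup>2\<close> and, for a slope \<open>\<theta>\<close> slightly below \<open>1\<close>, let \<open>n\<^sub>i\<close> minimize the length of \<open>a\<^sup>n z\<^sub>i\<close>
  minus \<open>\<theta> n\<close>. A limit \<open>h\<close> of the horofunctions of the inverses of \<open>a\<^sup>n z\<^sub>i\<close> with \<open>n = n\<^sub>i\<close> satisfies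
  \<open>h(a\<^sup>k) \<ge> \<theta> k - 1\<close> for all integers \<open>k\<close>. Conversely \<open>h(a\<^sup>k) + h(a\<^sup>-\<^sup>k)\<close> is bounded for arbitrarily
  large \<open>k\<close>: in a geodesic word at the minimizer one can choose a set of letters such that
  duplicating them all, or deleting them all, moves \<open>n\<^sub>i\<close> by \<open>k\<close> or \<open>-k\<close> and changes the area by
  an amount linear in the length of the word with a constant independent of \<open>k\<close>; conjugating by a bounded power of \<open>b\<close>
  repairs that at bounded cost. Hence \<open>h\<close> determines \<open>\<theta>\<close> and is not the horofunction of a group
  element, so that the boundary contains a copy of an interval. It is no larger, because the group
  is countable.
\<close>

section \<open>The Heisenberg group in symmetrized coordinates\<close>

text \<open>The third coordinate is symmetrized so that inversion is plain negation and powers scale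
  all coordinates linearly. The group is written additively, although it is not commutative, so that
  \<open>sum_list\<close> evaluates words.\<close>

datatype tri = Tri (px: int) (qx: int) (sx: int)

instantiation tri :: group_add
begin
definition "0 = Tri 0 0 0"
definition "x + y = Tri (px x + px y) (qx x + qx y) (sx x + sx y + px x * qx y - qx x * px y)"
definition "- x = Tri (- px x) (- qx x) (- sx x)"
definition "x - y = x + (- y :: tri)"
instance
  by standard (simp_all add: zero_tri_def plus_tri_def uminus_tri_def minus_tri_def algebra_simps)
end

lemma tri_sel [simp]:
  "px 0 = 0" "qx 0 = 0" "sx 0 = 0"
  "px (x + y) = px x + px y" "qx (x + y) = qx x + qx y"
  "sx (x + y) = sx x + sx y + px x * qx y - qx x * px y"
  "px (- x) = - px x" "qx (- x) = - qx x" "sx (- x) = - sx x"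
  by (simp_all add: zero_tri_def plus_tri_def uminus_tri_def)

lemma px_sum_list: "px (sum_list ws) = (\<Sum>t<length ws. px (ws ! t))"
  by (induction ws) (simp_all add: sum.lessThan_Suc_shift del: sum.lessThan_Suc)

lemma qx_sum_list: "qx (sum_list ws) = (\<Sum>t<length ws. qx (ws ! t))"
  by (induction ws) (simp_all add: sum.lessThan_Suc_shift del: sum.lessThan_Suc)

lemma sum_list_replicate_tri:
  "sum_list (replicate m x) = Tri (int m * px x) (int m * qx x) (int m * sx x)"
proof (induction m)
  case (Suc m)
  then show ?case by (auto simp: tri.expand algebra_simps intro!: tri.expand)
qed (simp add: zero_tri_def)

section \<open>The area of a word as a sum over pairs of letters\<close>

text \<open>Records which of two positions comes first. Together with the antisymmetric
  \<open>omega\<close> it yields a weight on pairs of positions that is symmetric, so that sums may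
  run over all ordered pairs.\<close>

definition sg :: "nat \<Rightarrow> nat \<Rightarrow> int" where
  "sg u t = (if u < t then 1 else if t < u then -1 else 0)"

lemma sg_swap: "sg t u = - sg u t"
  by (simp add: sg_def)

lemma abs_sg_le: "\<bar>sg u t\<bar> \<le> 1"
  by (simp add: sg_def)

text \<open>The symplectic form on the abelianization; twice its value is the central coordinate of
  the commutator of \<open>x\<close> and \<open>y\<close>.\<close>

definition omega :: "tri \<Rightarrow> tri \<Rightarrow> int" where
  "omega x y = px x * qx y - qx x * px y"

lemma omega_swap: "omega y x = - omega x y"
  by (simp add: omega_def)

text \<open>Multiplicity 0 deletes the letter at a position, 1 keeps it and 2 duplicates it, so the
  modified words used later are obtained by varying \<open>c\<close> alone.\<close>

definition weighted_word :: "(nat \<Rightarrow> nat) \<Rightarrow> (nat \<Rightarrow> 'a) \<Rightarrow> nat \<Rightarrow> 'a list" where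
  "weighted_word c X l = concat (map (\<lambda>t. replicate (c t) (X t)) [0..<l])"

lemma weighted_word_Suc:
  "weighted_word c X (Suc l) = weighted_word c X l @ replicate (c l) (X l)"
  by (simp add: weighted_word_def)

lemma length_weighted_word: "length (weighted_word c X l) = (\<Sum>t<l. c t)"
  by (induction l) (simp_all add: weighted_word_Suc, simp add: weighted_word_def)

lemma set_weighted_word: "set (weighted_word c X l) \<subseteq> X ` {..<l}"
  by (auto simp: weighted_word_def)

lemma weighted_word_one: "weighted_word (\<lambda>_. 1) (nth ws) (length ws) = ws"
proof -
  have "concat (map (\<lambda>t. [f t]) ts) = map f ts" for f :: "nat \<Rightarrow> 'a" and ts
    by (induction ts) auto
  then show ?thesis by (simp add: weighted_word_def map_nth)
qed

text \<open>The central coordinate collects \<open>omega\<close> over all pairs of letters in their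
  order; copies of one letter contribute nothing to each other. Counting each pair in both orders
  doubles it, which is why the third formula is stated for \<open>2 * sx\<close>.\<close>

lemma weighted_word_value:
  "px (sum_list (weighted_word c X l)) = (\<Sum>t<l. int (c t) * px (X t))"
  "qx (sum_list (weighted_word c X l)) = (\<Sum>t<l. int (c t) * qx (X t))"
  "2 * sx (sum_list (weighted_word c X l)) = 2 * (\<Sum>t<l. int (c t) * sx (X t))
     + (\<Sum>t<l. \<Sum>u<l. int (c u) * int (c t) * (sg u t * omega (X u) (X t)))"
proof -
  let ?V = "\<lambda>l. sum_list (weighted_word c X l)"
  show p: "px (?V l) = (\<Sum>t<l. int (c t) * px (X t))" for l
    by (induction l) (simp_all add: weighted_word_Suc sum_list_replicate_tri, simp add: weighted_word_def)
  show q: "qx (?V l) = (\<Sum>t<l. int (c t) * qx (X t))" for l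
    by (induction l) (simp_all add: weighted_word_Suc sum_list_replicate_tri, simp add: weighted_word_def)
  let ?f = "\<lambda>u t. int (c u) * int (c t) * (sg u t * omega (X u) (X t))"
  show "2 * sx (?V l) = 2 * (\<Sum>t<l. int (c t) * sx (X t)) + (\<Sum>t<l. \<Sum>u<l. ?f u t)"
  proof (induction l)
    case 0
    then show ?case by (simp add: weighted_word_def)
  next
    case (Suc l)
    have sym: "?f u t = ?f t u" for u t
      by (simp add: sg_swap[of t u] omega_swap[of "X u"])
    have "(\<Sum>t<Suc l. \<Sum>u<Suc l. ?f u t)
        = (\<Sum>t<l. \<Sum>u<l. ?f u t) + (\<Sum>t<l. ?f l t) + (\<Sum>u<l. ?f u l)"
      by (simp add: sum.distrib sg_def)
    also have "(\<Sum>t<l. ?f l t) = (\<Sum>u<l. ?f u l)"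
      by (intro sum.cong refl sym)
    also have "(\<Sum>u<l. ?f u l) = (\<Sum>u<l. int (c u) * px (X u)) * (int (c l) * qx (X l))
        - (\<Sum>u<l. int (c u) * qx (X u)) * (int (c l) * px (X l))"
      unfolding sum_distrib_right sum_subtractf[symmetric]
      by (intro sum.cong) (auto simp: sg_def omega_def algebra_simps)
    finally show ?case
      using Suc by (simp add: weighted_word_Suc sum_list_replicate_tri p q algebra_simps)
  qed
qed

section \<open>Counting and discrete intermediate value lemmas\<close>

text \<open>If no threshold \<open>r\<close> worked, then for a suitable \<open>r\<close> fewer than
  \<open>K\<close> indices would be exceptional on either side. Each of these contributes at most
  \<open>B * (2 * W + 1)\<close>, and every other index at most
  \<open>\<bar>q t\<bar> * (\<Delta> + 1)\<close>, which is too little for the assumed sum.\<close>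

lemma spread:
  fixes q R :: "'i \<Rightarrow> int" and K :: nat
  assumes fin: "finite I" and q0: "(\<Sum>t\<in>I. q t) = 0"
    and qB: "\<And>t. t \<in> I \<Longrightarrow> \<bar>q t\<bar> \<le> B" and RW: "\<And>t. t \<in> I \<Longrightarrow> \<bar>R t\<bar> \<le> W"
    and W: "W \<ge> 0" and \<Delta>: "\<Delta> \<ge> 0" and B: "B \<ge> 0"
    and U: "(\<Sum>t\<in>I. \<bar>q t\<bar>) \<le> U"
    and large: "2 * int K * (B * (2 * W + 1)) + U * (\<Delta> + 1) < (\<Sum>t\<in>I. q t * R t)"
  shows "\<exists>r. K \<le> card {t\<in>I. q t > 0 \<and> R t \<ge> r} \<and> K \<le> card {t\<in>I. q t < 0 \<and> R t \<le> r - \<Delta>}"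
proof (rule ccontr)
  assume contr: "\<not> ?thesis"
  define Up where "Up = (\<lambda>r. {t\<in>I. q t > 0 \<and> R t \<ge> r})"
  define Dn where "Dn = (\<lambda>r. {t\<in>I. q t < 0 \<and> R t \<le> r - \<Delta>})"
  have K0: "K > 0" using contr by (cases "K = 0") auto
  have top: "card (Up (W + 1)) < K"
  proof -
    have "Up (W + 1) = {}" using RW by (fastforce simp: Up_def)
    then show ?thesis using K0 by simp
  qed
  \<comment> \<open>Thresholds are scanned upwards from \<open>- W\<close>. At the first one with
    fewer than \<open>K\<close> upper indices, the preceding threshold \<open>r - 1\<close> still
    has enough of them, so by \<open>contr\<close> the lower set at \<open>r - 1\<close> must be
    small. This shift by one is the source of the summand 1 in \<open>\<Delta> + 1\<close>.\<close>
  define m where "m = (LEAST m. card (Up (int m - W)) < K)"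
  have ex: "card (Up (int (nat (2 * W + 1)) - W)) < K"
    using top W by (simp add: algebra_simps)
  have m1: "card (Up (int m - W)) < K"
    unfolding m_def by (rule LeastI) (rule ex)
  have m2: "m \<le> nat (2 * W + 1)"
    unfolding m_def by (rule Least_le) (rule ex)
  define r where "r = int m - W"
  have r: "- W \<le> r" "r \<le> W + 1" using m2 W by (auto simp: r_def)
  have c1: "card (Up r) < K" using m1 by (simp add: r_def)
  have c2: "card (Dn (r - 1)) < K"
  proof (cases m)
    case 0
    then have "Dn (r - 1) = {}" using RW \<Delta> by (fastforce simp: Dn_def r_def)
    then show ?thesis using K0 by simp
  next
    case (Suc m')
    have "\<not> card (Up (int m' - W)) < K"
      using Suc not_less_Least[of m' "\<lambda>m. card (Up (int m - W)) < K"] by (simp add: m_def)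
    then have "K \<le> card (Up (r - 1))" using Suc by (simp add: r_def algebra_simps)
    then show ?thesis using contr unfolding Up_def Dn_def not_ex by (meson not_le)
  qed
  define E where "E = B * (2 * W + 1)"
  have E0: "E \<ge> 0" using B W by (simp add: E_def)
  have pt: "q t * (R t - r) \<le> E * of_bool (t \<in> Up r) + E * of_bool (t \<in> Dn (r - 1)) + \<bar>q t\<bar> * (\<Delta> + 1)"
    if t: "t \<in> I" for t
  proof -
    have tB: "\<bar>q t\<bar> \<le> B" and tW: "\<bar>R t - r\<bar> \<le> 2 * W + 1"
      using qB RW t r by (auto simp: abs_le_iff dest!: spec) (smt (verit) RW t)+
    have le: "q t * (R t - r) \<le> E"
    proof -
      have "q t * (R t - r) \<le> \<bar>q t\<bar> * \<bar>R t - r\<bar>" by (metis abs_ge_self abs_mult)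
      also have "\<dots> \<le> E" unfolding E_def by (intro mult_mono tB tW) (use B in auto)
      finally show ?thesis .
    qed
    have q\<Delta>: "0 \<le> \<bar>q t\<bar> * (\<Delta> + 1)" using \<Delta> by simp
    consider "t \<in> Up r" | "t \<in> Dn (r - 1)" | "q t = 0" | "q t > 0" "R t < r" | "q t < 0" "R t > r - 1 - \<Delta>"
      using t by (auto simp: Up_def Dn_def) (metis linorder_neqE_linordered_idom not_le)
    then show ?thesis
    proof cases
      case 4
      then have "q t * (R t - r) \<le> 0" by (simp add: mult_nonneg_nonpos)
      then show ?thesis using q\<Delta> E0 by (smt (verit) of_bool_def mult_nonneg_nonneg)
    next
      case 5
      have "q t * (R t - r) = \<bar>q t\<bar> * (r - R t)" using 5 by (simp add: algebra_simps)
      also have "\<dots> \<le> \<bar>q t\<bar> * (\<Delta> + 1)" using 5 by (intro mult_left_mono) auto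
      finally show ?thesis using E0 by (smt (verit) of_bool_def mult_nonneg_nonneg)
    qed (use le q\<Delta> E0 in auto)
  qed
  have fU: "finite (Up r)" "finite (Dn (r - 1))" "Up r \<subseteq> I" "Dn (r - 1) \<subseteq> I"
    using fin by (auto simp: Up_def Dn_def)
  have cnt: "(\<Sum>t\<in>I. E * of_bool (t \<in> A)) = E * int (card A)" if "A \<subseteq> I" for A
  proof -
    have "(\<Sum>t\<in>I. E * of_bool (t \<in> A)) = (\<Sum>t\<in>A. E)"
      using that fin by (intro sum.mono_neutral_cong_right) auto
    then show ?thesis by simp
  qed
  \<comment> \<open>Since \<open>q\<close> sums to zero, \<open>R\<close> may be centred at
    \<open>r\<close> at no cost.\<close>
  have "(\<Sum>t\<in>I. q t * R t) = (\<Sum>t\<in>I. q t * (R t - r)) + r * (\<Sum>t\<in>I. q t)"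
    by (simp add: sum_distrib_left sum.distrib[symmetric] algebra_simps)
  also have "\<dots> = (\<Sum>t\<in>I. q t * (R t - r))" using q0 by simp
  also have "\<dots> \<le> (\<Sum>t\<in>I. E * of_bool (t \<in> Up r) + E * of_bool (t \<in> Dn (r - 1)) + \<bar>q t\<bar> * (\<Delta> + 1))"
    by (rule sum_mono) (rule pt)
  also have "\<dots> = E * int (card (Up r)) + E * int (card (Dn (r - 1))) + (\<Sum>t\<in>I. \<bar>q t\<bar>) * (\<Delta> + 1)"
    using fU by (simp add: sum.distrib cnt sum_distrib_right)
  also have "\<dots> \<le> E * int K + E * int K + U * (\<Delta> + 1)"
    using c1 c2 E0 U \<Delta> by (intro add_mono mult_left_mono mult_right_mono) auto
  also have "\<dots> = 2 * int K * (B * (2 * W + 1)) + U * (\<Delta> + 1)" by (simp add: E_def algebra_simps)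
  finally show False using large by simp
qed

text \<open>Increments of at least \<open>L\<close> make \<open>f\<close> attain
  \<open>\<bar>x\<bar>\<close> within \<open>m\<close> steps; increments of at most \<open>U\<close>
  bound the overshoot at the first such step. The sign is chosen opposite to that of
  \<open>x\<close>.\<close>

lemma signed_partial_sum:
  fixes f :: "nat \<Rightarrow> int"
  assumes f0: "f 0 = 0" and lo: "\<And>j. j < m \<Longrightarrow> f j + L \<le> f (Suc j)"
    and up: "\<And>j. j < m \<Longrightarrow> f (Suc j) \<le> f j + U" and U: "U \<ge> 0" and x: "\<bar>x\<bar> \<le> int m * L"
  shows "\<exists>\<nu>\<le>m. \<exists>s\<in>{1,-1}. \<bar>x + s * f \<nu>\<bar> \<le> U"
proof -
  have "j \<le> m \<Longrightarrow> int j * L \<le> f j" for j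
  proof (induction j)
    case (Suc j)
    then show ?case using lo[of j] by (simp add: algebra_simps)
  qed (simp add: f0)
  then have ex: "\<bar>x\<bar> \<le> f m" using x by (meson order.refl order.trans)
  define \<nu> where "\<nu> = (LEAST j. \<bar>x\<bar> \<le> f j)"
  have \<nu>: "\<bar>x\<bar> \<le> f \<nu>" "\<nu> \<le> m"
    unfolding \<nu>_def using ex by (auto intro: LeastI Least_le)
  have "f \<nu> \<le> \<bar>x\<bar> + U"
  proof (cases \<nu>)
    case 0
    then show ?thesis using f0 U by simp
  next
    case (Suc j)
    have "\<not> \<bar>x\<bar> \<le> f j" using Suc not_less_Least[of j "\<lambda>j. \<bar>x\<bar> \<le> f j"] by (simp add: \<nu>_def)
    then show ?thesis using Suc up[of j] \<nu>(2) by simp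
  qed
  then have "\<bar>x + (if x \<ge> 0 then -1 else 1) * f \<nu>\<bar> \<le> U" using \<nu>(1) by auto
  then show ?thesis using \<nu>(2) by (intro exI[of _ \<nu>] conjI bexI[of _ "if x \<ge> 0 then -1 else 1"]) auto
qed

text \<open>The first index at which \<open>f\<close> attains \<open>e\<close> overshoots by at most
  one upward jump.\<close>

lemma discrete_ivt:
  fixes f :: "nat \<Rightarrow> int"
  assumes "f 0 = 0" "0 \<le> e" "e \<le> f m" "\<And>j. j < m \<Longrightarrow> f (Suc j) \<le> f j + d" "d \<ge> 0"
  shows "\<exists>j\<le>m. \<bar>f j - e\<bar> \<le> d"
proof -
  define j where "j = (LEAST j. e \<le> f j)"
  have j: "e \<le> f j" "j \<le> m"
    unfolding j_def using assms(3) by (auto intro: LeastI Least_le)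
  have "f j \<le> e + d"
  proof (cases j)
    case 0
    then show ?thesis using assms by simp
  next
    case (Suc k)
    have "\<not> e \<le> f k" using Suc not_less_Least[of k "\<lambda>j. e \<le> f j"] by (simp add: j_def)
    then show ?thesis using Suc assms(4)[of k] j(2) by simp
  qed
  then show ?thesis using j by (intro exI[of _ j]) auto
qed

section \<open>Word length in an additive monoid\<close>

definition reach :: "'a::monoid_add set \<Rightarrow> 'a set" where
  "reach T = sum_list ` lists T"

definition wlen :: "'a::monoid_add set \<Rightarrow> 'a \<Rightarrow> nat" where
  "wlen T x = (LEAST n. \<exists>ws. length ws = n \<and> set ws \<subseteq> T \<and> sum_list ws = x)"

lemma reachI: "set ws \<subseteq> T \<Longrightarrow> sum_list ws \<in> reach T"
  by (auto simp: reach_def)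

lemma wlen_le: "set ws \<subseteq> T \<Longrightarrow> wlen T (sum_list ws) \<le> length ws"
  unfolding wlen_def by (rule Least_le) auto

lemma geodesic:
  assumes "x \<in> reach T"
  obtains ws where "set ws \<subseteq> T" "sum_list ws = x" "length ws = wlen T x"
proof -
  obtain ws where "set ws \<subseteq> T" "sum_list ws = x" using assms by (auto simp: reach_def)
  then have "\<exists>n ws. length ws = n \<and> set ws \<subseteq> T \<and> sum_list ws = x" by blast
  from LeastI_ex[OF this] show ?thesis using that by (auto simp: wlen_def)
qed

lemma reach_0 [simp]: "0 \<in> reach T"
  using reachI[of "[]" T] by simp

lemma reach_add:
  assumes "x \<in> reach T" "y \<in> reach T"
  shows "x + y \<in> reach T"
proof -
  obtain v w where "set v \<subseteq> T" "sum_list v = x" "set w \<subseteq> T" "sum_list w = y"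
    using assms by (auto simp: reach_def)
  then show ?thesis using reachI[of "v @ w" T] by simp
qed

lemma reach_uminus:
  fixes T :: "'a::group_add set"
  assumes neg: "\<And>x. x \<in> T \<Longrightarrow> - x \<in> T" and x: "x \<in> reach T"
  shows "- x \<in> reach T"
proof -
  obtain ws where "set ws \<subseteq> T" "sum_list ws = x" using x by (auto simp: reach_def)
  moreover have "set ws \<subseteq> T \<Longrightarrow> - sum_list ws \<in> reach T"
  proof (induction ws)
    case (Cons y ws)
    have "- y \<in> reach T" using reachI[of "[- y]" T] neg Cons by simp
    then show ?case using Cons reach_add[of "- sum_list ws" T "- y"] by (simp add: minus_add)
  qed simp
  ultimately show ?thesis by simp
qed

lemma wlen_add:
  assumes "x \<in> reach T" "y \<in> reach T"
  shows "wlen T (x + y) \<le> wlen T x + wlen T y"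
proof -
  obtain v w where "set v \<subseteq> T" "sum_list v = x" "length v = wlen T x"
    and "set w \<subseteq> T" "sum_list w = y" "length w = wlen T y"
    using assms by (metis geodesic)
  then show ?thesis using wlen_le[of "v @ w" T] by simp
qed

lemma abs_sum_lessThan_le:
  fixes f :: "nat \<Rightarrow> int"
  assumes "\<And>t. t < l \<Longrightarrow> \<bar>f t\<bar> \<le> B"
  shows "\<bar>\<Sum>t<l. f t\<bar> \<le> int l * B"
proof -
  have "\<bar>\<Sum>t<l. f t\<bar> \<le> (\<Sum>t<l. B)"
    by (rule order_trans[OF sum_abs]) (intro sum_mono, use assms in auto)
  then show ?thesis by simp
qed

section \<open>Alphabets in adapted coordinates and the repair of area\<close>

text \<open>The alphabet of a word metric, in coordinates adapted to a letter \<^term>\<open>Tri D 0 0\<close>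
  that is the only one, up to its central coordinate, to maximise \<^const>\<open>px\<close>.\<close>

locale heis_letters =
  fixes T :: "tri set" and D B :: int and b :: tri
  assumes fin: "finite T" and neg: "x \<in> T \<Longrightarrow> - x \<in> T"
    and aT: "Tri D 0 0 \<in> T" and D1: "1 \<le> D" and DB: "D \<le> B"
    and pD: "x \<in> T \<Longrightarrow> px x \<le> D" and qD: "x \<in> T \<Longrightarrow> px x = D \<Longrightarrow> qx x = 0"
    and pB: "x \<in> T \<Longrightarrow> \<bar>px x\<bar> \<le> B" and qB: "x \<in> T \<Longrightarrow> \<bar>qx x\<bar> \<le> B" and sB: "x \<in> T \<Longrightarrow> \<bar>sx x\<bar> \<le> B"
    and bT: "b \<in> T" and b1: "1 \<le> qx b"
begin

lemma B1: "1 \<le> B" using D1 DB by simp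

lemma px_word_le:
  assumes "set ws \<subseteq> T"
  shows "px (sum_list ws) \<le> int (length ws) * D"
proof -
  have "px (sum_list ws) \<le> (\<Sum>t<length ws. D)"
    unfolding px_sum_list using assms pD nth_mem by (intro sum_mono) blast
  then show ?thesis by simp
qed

lemma px_wlen: "x \<in> reach T \<Longrightarrow> px x \<le> int (wlen T x) * D"
  by (metis geodesic px_word_le)

lemma wlen_uminus_le:
  assumes "x \<in> reach T"
  shows "wlen T (- x) \<le> wlen T x"
proof -
  obtain ws where ws: "set ws \<subseteq> T" "sum_list ws = x" "length ws = wlen T x"
    using assms by (rule geodesic)
  have "sum_list (rev (map uminus ws)) = - sum_list ws"
    by (induction ws) (simp_all add: minus_add)
  moreover have "set (rev (map uminus ws)) \<subseteq> T" using ws neg by auto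
  ultimately show ?thesis using wlen_le[of "rev (map uminus ws)" T] ws by simp
qed

lemma wlen_uminus: "x \<in> reach T \<Longrightarrow> wlen T (- x) = wlen T x"
  using wlen_uminus_le[of x] wlen_uminus_le[of "- x"] reach_uminus[OF neg, of x] by simp

lemma abs_px_wlen: "x \<in> reach T \<Longrightarrow> \<bar>px x\<bar> \<le> int (wlen T x) * D"
  using px_wlen[of x] px_wlen[of "- x"] reach_uminus[OF neg, of x] wlen_uminus[of x] by simp

lemma power_reach: "Tri (n * D) 0 0 \<in> reach T"
proof (cases "n \<ge> 0")
  case True
  have "sum_list (replicate (nat n) (Tri D 0 0)) = Tri (n * D) 0 0"
    using True by (simp add: sum_list_replicate_tri)
  then show ?thesis using reachI[of "replicate (nat n) (Tri D 0 0)" T] aT by (metis empty_subsetI insert_subset set_replicate_conv_if)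
next
  case False
  have "sum_list (replicate (nat (-n)) (- Tri D 0 0)) = Tri (n * D) 0 0"
    using False by (simp add: sum_list_replicate_tri)
  then show ?thesis using reachI[of "replicate (nat (-n)) (- Tri D 0 0)" T] neg[OF aT]
    by (metis empty_subsetI insert_subset set_replicate_conv_if)
qed

text \<open>Conjugation by a power of \<^term>\<open>b\<close> produces the area of a rectangle.\<close>

lemma rectangle:
  assumes "0 \<le> n"
  shows "Tri (n * D) 0 (2 * D * qx b * n * int j) \<in> reach T"
    and "int (wlen T (Tri (n * D) 0 (2 * D * qx b * n * int j))) \<le> n + 2 * int j"
proof -
  let ?ws = "replicate j (- b) @ replicate (nat n) (Tri D 0 0) @ replicate j b"
  have ws: "set ?ws \<subseteq> T" using aT bT neg by auto
  have "sum_list ?ws = Tri (n * D) 0 (2 * D * qx b * n * int j)"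
    using assms by (auto simp: sum_list_replicate_tri algebra_simps intro!: tri.expand)
  then show "Tri (n * D) 0 (2 * D * qx b * n * int j) \<in> reach T"
    and "int (wlen T (Tri (n * D) 0 (2 * D * qx b * n * int j))) \<le> n + 2 * int j"
    using reachI[OF ws] wlen_le[OF ws] assms by (auto simp: le_nat_iff nat_le_iff)
qed

text \<open>A rectangle of width \<open>m\<close> creates the area; a further power of
  \<open>Tri D 0 0\<close> then moves the endpoint to any \<open>n\<close>, adding no area because
  both factors have zero \<open>qx\<close>.\<close>

lemma area_reach: 
  assumes "0 \<le> m"
  shows "Tri (n * D) 0 (2 * D * qx b * m * int j) \<in> reach T"
proof -
  have "Tri (n * D) 0 (2 * D * qx b * m * int j)
      = Tri ((n - m) * D) 0 0 + Tri (m * D) 0 (2 * D * qx b * m * int j)"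
    by (auto simp: algebra_simps intro!: tri.expand)
  then show ?thesis using rectangle(1)[OF assms] power_reach reach_add by metis
qed

lemma finite_central: "finite {x \<in> reach T. px x = 0 \<and> qx x = 0 \<and> \<bar>sx x\<bar> \<le> c}"
proof (rule finite_subset)
  show "{x \<in> reach T. px x = 0 \<and> qx x = 0 \<and> \<bar>sx x\<bar> \<le> c} \<subseteq> Tri 0 0 ` {-c..c}"
  proof
    fix x assume "x \<in> {x \<in> reach T. px x = 0 \<and> qx x = 0 \<and> \<bar>sx x\<bar> \<le> c}"
    then have "x = Tri 0 0 (sx x)" "sx x \<in> {-c..c}" by (auto intro!: tri.expand)
    then show "x \<in> Tri 0 0 ` {-c..c}" by blast
  qed
qed simp

text \<open>The inserted 0 keeps the maximum meaningful when \<open>c\<close> is negative and the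
  set of central elements is empty.\<close>

definition central_bound :: "int \<Rightarrow> nat" where
  "central_bound c = Max (wlen T ` {x \<in> reach T. px x = 0 \<and> qx x = 0 \<and> \<bar>sx x\<bar> \<le> c} \<union> {0})"

lemma wlen_central_le:
  assumes "Tri 0 0 e \<in> reach T" "\<bar>e\<bar> \<le> c"
  shows "wlen T (Tri 0 0 e) \<le> central_bound c"
  unfolding central_bound_def using finite_central assms by (intro Max_ge) auto

text \<open>An area defect is repaired by conjugating a prefix \<open>u\<close> of the word with a power of \<^term>\<open>b\<close>:
  this changes the area in steps of bounded size as \<open>u\<close> grows, so that a bounded central
  element remains.\<close>

lemma fix_area:
  fixes r :: nat
  assumes ws: "set ws \<subseteq> T" and val: "sum_list ws = Tri P 0 s" and P: "P \<ge> 0"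
    and e: "\<bar>M - s\<bar> \<le> 2 * int r * P" and reach: "Tri P 0 M \<in> reach T"
  shows "wlen T (Tri P 0 M) \<le> length ws + 2 * r + central_bound (4 * int r * B\<^sup>2)"
proof -
  \<comment> \<open>The direction of \<open>b'\<close> is chosen so that conjugating the whole word
    changes the area towards \<open>M\<close>.\<close>
  define \<epsilon> :: int where "\<epsilon> = (if M - s \<ge> 0 then 1 else -1)"
  define b' where "b' = (if M - s \<ge> 0 then - b else b)"
  have b'T: "b' \<in> T" "- b' \<in> T" using bT neg by (auto simp: b'_def)
  have qb': "qx b' = - \<epsilon> * qx b" by (simp add: b'_def \<epsilon>_def)
  \<comment> \<open>Conjugating the prefix of length \<open>j\<close> by \<open>r\<close> copies of
    \<open>b'\<close> changes the area by \<open>2 * r * omega b'\<close> of that prefix. Normalized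
    by the sign, this starts at 0, ends at or above \<open>\<bar>M - s\<bar>\<close> and has bounded
    increments.\<close>
  define f where "f = (\<lambda>j. \<epsilon> * (2 * int r * omega b' (sum_list (take j ws))))"
  have "\<exists>j\<le>length ws. \<bar>f j - \<bar>M - s\<bar>\<bar> \<le> 4 * int r * B\<^sup>2"
  proof (rule discrete_ivt)
    show "f 0 = 0" by (simp add: f_def omega_def)
    have "f (length ws) = 2 * int r * (qx b * P)"
      by (simp add: f_def val omega_def qb' \<epsilon>_def)
    moreover have "2 * int r * (1 * P) \<le> 2 * int r * (qx b * P)"
      using P b1 by (intro mult_left_mono mult_right_mono) auto
    ultimately show "\<bar>M - s\<bar> \<le> f (length ws)" using e by simp
    fix j assume j: "j < length ws"
    then have y: "ws ! j \<in> T" using ws nth_mem by blast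
    have om: "\<bar>omega b' (ws ! j)\<bar> \<le> B * B + B * B"
    proof -
      have "\<bar>omega b' (ws ! j)\<bar> \<le> \<bar>px b'\<bar> * \<bar>qx (ws ! j)\<bar> + \<bar>qx b'\<bar> * \<bar>px (ws ! j)\<bar>"
      unfolding omega_def abs_mult[symmetric] by (rule abs_triangle_ineq4)
      also have "\<dots> \<le> B * B + B * B"
      using pB[OF y] qB[OF y] pB[OF b'T(1)] qB[OF b'T(1)] B1 by (intro add_mono mult_mono) auto
      finally show ?thesis .
    qed
    have "f (Suc j) = f j + \<epsilon> * (2 * int r * omega b' (ws ! j))"
      using j by (simp add: f_def take_Suc_conv_app_nth omega_def algebra_simps)
    also have "\<epsilon> * (2 * int r * omega b' (ws ! j)) \<le> \<bar>\<epsilon> * (2 * int r * omega b' (ws ! j))\<bar>" by simp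
    also have "\<dots> = 2 * int r * \<bar>omega b' (ws ! j)\<bar>" by (simp add: \<epsilon>_def abs_mult)
    also have "2 * int r * \<bar>omega b' (ws ! j)\<bar> \<le> 2 * int r * (B * B + B * B)"
      by (intro mult_left_mono om) auto
    also have "f j + 2 * int r * (B * B + B * B) = f j + 4 * int r * B\<^sup>2"
      by (simp add: power2_eq_square algebra_simps)
    finally show "f (Suc j) \<le> f j + 4 * int r * B\<^sup>2"
      by (simp add: power2_eq_square)
  qed auto
  then obtain j where j: "j \<le> length ws" "\<bar>f j - \<bar>M - s\<bar>\<bar> \<le> 4 * int r * B\<^sup>2" by blast
  define g where "g = \<epsilon> * f j"
  have g: "\<bar>M - s - g\<bar> \<le> 4 * int r * B\<^sup>2" using j(2) by (auto simp: g_def \<epsilon>_def split: if_splits)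
  let ?u = "take j ws" and ?v = "drop j ws"
  let ?w = "replicate r b' @ ?u @ replicate r (- b') @ ?v"
  have uv: "sum_list ?u + sum_list ?v = Tri P 0 s"
    by (metis append_take_drop_id sum_list_append val)
  have \<epsilon>2: "\<epsilon> * (\<epsilon> * x) = x" for x by (simp add: \<epsilon>_def)
  have w: "set ?w \<subseteq> T" using ws b'T by (auto dest: in_set_takeD in_set_dropD)
  have conj: "sum_list (replicate r b') + sum_list ?u + sum_list (replicate r (- b')) = sum_list ?u + Tri 0 0 g"
    by (auto simp: sum_list_replicate_tri g_def f_def \<epsilon>2 omega_def algebra_simps intro!: tri.expand)
  have central: "Tri 0 0 g + x = x + Tri 0 0 g" for x
    by (auto intro!: tri.expand)
  have wv: "sum_list ?w = Tri P 0 (s + g)"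
  proof -
    have "sum_list ?w = sum_list ?u + Tri 0 0 g + sum_list ?v"
      unfolding conj[symmetric] by (simp add: add.assoc)
    also have "\<dots> = sum_list ?u + sum_list ?v + Tri 0 0 g" by (simp add: add.assoc central)
    finally show ?thesis unfolding uv by (auto intro!: tri.expand)
  qed
  have eq: "Tri P 0 M = sum_list ?w + Tri 0 0 (M - s - g)"
    unfolding wv by (auto intro!: tri.expand)
  \<comment> \<open>Not every central triple needs to be reachable; this one is, being the quotient
    of two reachable elements, so that \<open>central_bound\<close> applies to it.\<close>
  then have "Tri 0 0 (M - s - g) = - sum_list ?w + Tri P 0 M" by (metis minus_add_cancel)
  then have c: "Tri 0 0 (M - s - g) \<in> reach T"
    using reach reachI[OF w] reach_uminus[OF neg] reach_add by metis
  have "wlen T (Tri P 0 M) \<le> wlen T (sum_list ?w) + wlen T (Tri 0 0 (M - s - g))"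
    unfolding eq by (intro wlen_add reachI w c)
  moreover have "wlen T (sum_list ?w) \<le> length ws + 2 * r"
    using wlen_le[OF w] j(1) by simp
  ultimately show ?thesis using wlen_central_le[OF c g] by linarith
qed

end

section \<open>Thin words and their first-order perturbations\<close>

lemma card_le_inj_on:
  assumes "m \<le> card A"
  obtains x :: "nat \<Rightarrow> 'a" where "inj_on x {..<m}" "x ` {..<m} \<subseteq> A"
proof (cases "m = 0")
  case False
  then have fin: "finite A" using assms card.infinite by fastforce
  then obtain x where x: "bij_betw x {0..<card A} A" using ex_bij_betw_nat_finite by blast
  have "{..<m} \<subseteq> {0..<card A}" using assms by auto
  then show ?thesis using x that[of x] by (auto simp: bij_betw_def intro: inj_on_subset)
qed (use that in simp)

lemma pigeonhole_image:
  assumes T: "finite T" and A: "finite A" "f ` A \<subseteq> T" and card: "card T * m \<le> card A" and m: "m > 0" "T \<noteq> {}"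
  shows "\<exists>x\<in>T. m \<le> card {t\<in>A. f t = x}"
proof (rule ccontr)
  assume "\<not> ?thesis"
  then have lt: "card {t\<in>A. f t = x} < m" if "x \<in> T" for x using that by (simp add: not_le)
  have "card A = card (\<Union>x\<in>T. {t\<in>A. f t = x})" using A by (intro arg_cong[of _ _ card]) auto
  also have "\<dots> \<le> (\<Sum>x\<in>T. card {t\<in>A. f t = x})" using T by (rule card_UN_le)
  also have "\<dots> < (\<Sum>x\<in>T. m)" using lt T m by (intro sum_strict_mono) auto
  finally show False using card by simp
qed

text \<open>The word exceeds the shortest conceivable length \<open>n\<close> by at most
  \<open>6 * i\<close>, yet it carries the area of a rectangle of height \<open>i\<close> and width
  \<open>384 * B^7 * i\<close>. This forces it to be long and mostly horizontal.\<close>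

locale thin_word = heis_letters +
  fixes ws :: "tri list" and n i :: int
  assumes wsT: "set ws \<subseteq> T"
    and val: "sum_list ws = Tri (n * D) 0 (2 * D * qx b * (384 * B^7 * i) * i)"
    and thin: "int (length ws) - n \<le> 6 * i" and i1: "1 \<le> i"
begin

abbreviation (input) l where "l \<equiv> length ws"
abbreviation (input) X where "X \<equiv> nth ws"

text \<open>Horizontal displacement before position \<open>t\<close> minus that after it;
  \<open>H\<close> is the vertical analogue.\<close>

definition R :: "nat \<Rightarrow> int" where "R t = (\<Sum>u<l. sg u t * px (X u))"
definition H :: "nat \<Rightarrow> int" where "H t = (\<Sum>u<l. sg u t * qx (X u))"
text \<open>To first order, duplicating the letter at position \<open>t\<close> changes the area by \<open>lam t\<close>.\<close>

definition lam :: "nat \<Rightarrow> int" where "lam t = sx (X t) + qx (X t) * R t - px (X t) * H t"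

lemma XT: "t < l \<Longrightarrow> X t \<in> T"
  using wsT nth_mem by blast

lemma sum_px: "(\<Sum>t<l. px (X t)) = n * D"
  using px_sum_list[of ws] val by simp

lemma sum_qx: "(\<Sum>t<l. qx (X t)) = 0"
  using qx_sum_list[of ws] val by simp

text \<open>Every such letter loses at least 1 against the maximal advance \<open>D\<close>, and the
  total loss is \<open>(l - n) * D\<close>.\<close>

lemma card_nonmax: "int (card {t. t < l \<and> px (X t) < D}) \<le> 6 * D * i"
proof -
  have "int (card {t. t < l \<and> px (X t) < D}) = (\<Sum>t<l. of_bool (px (X t) < D))"
    by (simp add: sum_of_bool_eq Int_def)
  also have "\<dots> \<le> (\<Sum>t<l. D - px (X t))"
    using XT pD by (intro sum_mono) (auto simp: of_bool_def)
  also have "\<dots> = (int l - n) * D" by (simp add: sum_subtractf sum_px algebra_simps)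
  also have "\<dots> \<le> (6 * i) * D" using thin D1 by (intro mult_right_mono) auto
  finally show ?thesis by (simp add: mult_ac)
qed

text \<open>Letters of maximal \<open>px\<close> have zero \<open>qx\<close>, so only the few
  letters counted in \<open>card_nonmax\<close> move vertically.\<close>

lemma sum_abs_qx: "(\<Sum>t<l. \<bar>qx (X t)\<bar>) \<le> 6 * B\<^sup>2 * i"
proof -
  have "(\<Sum>t<l. \<bar>qx (X t)\<bar>) = (\<Sum>t | t < l \<and> px (X t) < D. \<bar>qx (X t)\<bar>)"
    using XT qD pD by (intro sum.mono_neutral_right) (auto simp: order_less_le)
  also have "\<dots> \<le> (\<Sum>t | t < l \<and> px (X t) < D. B)"
    using XT qB by (intro sum_mono) auto
  also have "\<dots> = int (card {t. t < l \<and> px (X t) < D}) * B" by simp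
  also have "\<dots> \<le> (6 * D * i) * B" using card_nonmax B1 by (intro mult_right_mono) auto
  also have "\<dots> = (6 * B * i) * D" by simp
  also have "\<dots> \<le> (6 * B * i) * B" using DB B1 i1 by (intro mult_left_mono) auto
  finally show ?thesis by (simp add: power2_eq_square mult_ac)
qed

lemma abs_H: "\<bar>H t\<bar> \<le> 6 * B\<^sup>2 * i"
proof -
  have "\<bar>H t\<bar> \<le> (\<Sum>u<l. \<bar>sg u t * qx (X u)\<bar>)" unfolding H_def by (rule sum_abs)
  also have "\<dots> \<le> (\<Sum>u<l. \<bar>qx (X u)\<bar>)"
    by (intro sum_mono) (auto simp: sg_def)
  finally show ?thesis using sum_abs_qx by linarith
qed

lemma abs_R: "\<bar>R t\<bar> \<le> B * int l"
proof -
  have "\<bar>R t\<bar> \<le> int l * B" unfolding R_def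
    using XT pB B1 by (intro abs_sum_lessThan_le) (auto simp: sg_def)
  then show ?thesis by (simp add: mult.commute)
qed

lemma sum_sg_omega:
  "(\<Sum>u<l. sg u t * omega (X u) (X t)) = qx (X t) * R t - px (X t) * H t"
  by (simp add: R_def H_def omega_def sum_distrib_left sum_subtractf[symmetric] algebra_simps)

text \<open>Summation by parts: exchanging the two positions turns the \<open>H\<close> half of the
  pair sum into the \<open>R\<close> half. The area is thus carried by the vertical letters,
  weighted by their horizontal position, up to the sum of the \<open>sx\<close>.\<close>

lemma area: "2 * D * qx b * (384 * B^7 * i) * i = (\<Sum>t<l. sx (X t)) + (\<Sum>t<l. qx (X t) * R t)"
proof -
  have swap: "(\<Sum>t<l. px (X t) * H t) = - (\<Sum>t<l. qx (X t) * R t)"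
  proof -
    have "(\<Sum>t<l. px (X t) * H t) = (\<Sum>t<l. \<Sum>u<l. px (X t) * (sg u t * qx (X u)))"
      by (simp add: H_def sum_distrib_left)
    also have "\<dots> = (\<Sum>u<l. \<Sum>t<l. px (X t) * (sg u t * qx (X u)))" by (rule sum.swap)
    also have "\<dots> = - (\<Sum>u<l. qx (X u) * R u)"
      unfolding R_def sum_distrib_left sum_negf[symmetric]
      by (intro sum.cong refl) (simp add: sg_def)
    finally show ?thesis .
  qed
  have "2 * (2 * D * qx b * (384 * B^7 * i) * i)
      = 2 * (\<Sum>t<l. sx (X t)) + (\<Sum>t<l. \<Sum>u<l. sg u t * omega (X u) (X t))"
    using weighted_word_value(3)[of "\<lambda>_. 1" X l] by (simp add: weighted_word_one[unfolded One_nat_def] val)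
  also have "(\<Sum>t<l. \<Sum>u<l. sg u t * omega (X u) (X t)) = 2 * (\<Sum>t<l. qx (X t) * R t)"
    by (simp add: sum_sg_omega sum_subtractf swap)
  finally show ?thesis by simp
qed

lemma abs_sum_sx: "\<bar>\<Sum>t<l. sx (X t)\<bar> \<le> B * int l"
  using abs_sum_lessThan_le[of l "\<lambda>t. sx (X t)" B] XT sB by (auto simp: mult.commute)

lemma area_ge: "768 * B^7 * i\<^sup>2 \<le> 2 * D * qx b * (384 * B^7 * i) * i"
proof -
  have "1 * 1 \<le> D * qx b" using D1 b1 by (intro mult_mono) auto
  then have "1 * (768 * B^7 * i\<^sup>2) \<le> (D * qx b) * (768 * B^7 * i\<^sup>2)"
    using B1 i1 by (intro mult_right_mono) auto
  then show ?thesis by (simp add: power2_eq_square mult_ac)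
qed

text \<open>The area is at most of the order of the total vertical movement, itself of order
  \<open>i\<close>, times the length; as it is at least \<open>768 * B^7 * i\<^sup>2\<close>, the
  length must be large compared with \<open>i\<close>.\<close>

lemma long: "96 * B^4 * i \<le> int l"
proof -
  have "(\<Sum>t<l. qx (X t) * R t) \<le> (\<Sum>t<l. \<bar>qx (X t)\<bar> * (B * int l))"
  proof (intro sum_mono)
    fix t
    have "qx (X t) * R t \<le> \<bar>qx (X t)\<bar> * \<bar>R t\<bar>" unfolding abs_mult[symmetric] by (rule abs_ge_self)
    also have "\<dots> \<le> \<bar>qx (X t)\<bar> * (B * int l)" by (intro mult_left_mono abs_R) simp
    finally show "qx (X t) * R t \<le> \<bar>qx (X t)\<bar> * (B * int l)" .
  qed
  also have "\<dots> = (\<Sum>t<l. \<bar>qx (X t)\<bar>) * (B * int l)" by (simp add: sum_distrib_right)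
  also have "\<dots> \<le> (6 * B\<^sup>2 * i) * (B * int l)"
    using sum_abs_qx B1 by (intro mult_right_mono) auto
  finally have "768 * B^7 * i\<^sup>2 \<le> B * int l + (6 * B\<^sup>2 * i) * (B * int l)"
    using area area_ge abs_sum_sx by linarith
  moreover have "B * int l \<le> (B\<^sup>2 * i) * (B * int l)"
  proof -
    have "1 * 1 \<le> B\<^sup>2 * i" using B1 i1 by (intro mult_mono) auto
    then have "1 * (B * int l) \<le> (B\<^sup>2 * i) * (B * int l)" using B1 by (intro mult_right_mono) auto
    then show ?thesis by simp
  qed
  ultimately have "768 * B^7 * i\<^sup>2 \<le> 7 * ((B\<^sup>2 * i) * (B * int l))" by (simp add: mult.assoc)
  then have "(B^3 * i) * (768 * B^4 * i) \<le> (B^3 * i) * (7 * int l)"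
    by (simp add: eval_nat_numeral algebra_simps)
  then have le: "768 * B^4 * i \<le> 7 * int l" using B1 i1 by simp
  moreover have "0 \<le> B^4 * i" using B1 i1 by simp
  ultimately show ?thesis by linarith
qed

definition sel :: "nat set \<Rightarrow> nat set \<Rightarrow> int \<Rightarrow> nat \<Rightarrow> int" where
  "sel A V s t = of_bool (t \<in> A) + s * of_bool (t \<in> V)"

lemma sum_sel:
  assumes "A \<subseteq> {..<l}" "V \<subseteq> {..<l}"
  shows "(\<Sum>t<l. sel A V s t * g t) = sum g A + s * sum g V"
proof -
  have "(\<Sum>t<l. of_bool (t \<in> C) * g t) = sum g C" if "C \<subseteq> {..<l}" for C
    using that by (intro sum.mono_neutral_cong_right) auto
  then show ?thesis using assms
    by (simp add: sel_def distrib_right sum.distrib mult.assoc sum_distrib_left[symmetric])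
qed

text \<open>Duplicating letters of maximal \<^const>\<open>px\<close> changes the area to first order by little, because the
  word is thin; a few letters going up far to the right and letters going down
  far to the left compensate for this change.\<close>

lemma perturbation:
  fixes K :: nat
  assumes large: "2 * int (card T * (K * nat (B * B))) * (B * (2 * (B * int l) + 1)) + B * int l + 6 * B\<^sup>2 * i
      < 384 * B^7 * i\<^sup>2"
    and iK: "int K \<le> i"
  shows "\<exists>\<epsilon> k. (\<forall>t<l. \<bar>\<epsilon> t\<bar> \<le> 1) \<and> (\<Sum>t<l. \<bar>\<epsilon> t\<bar>) \<le> 6 * B\<^sup>2 * int K
    \<and> (\<Sum>t<l. \<epsilon> t * qx (X t)) = 0 \<and> (\<Sum>t<l. \<epsilon> t * px (X t)) = k * D
    \<and> int K \<le> k \<and> k \<le> 6 * B\<^sup>2 * int K \<and> \<bar>\<Sum>t<l. \<epsilon> t * lam t\<bar> \<le> 6 * B^5 * int l"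
proof (cases "K = 0")
  case True
  then show ?thesis using B1 by (intro exI[of _ "\<lambda>_. 0"] exI[of _ 0]) auto
next
  case K: False
  \<comment> \<open>At most \<open>K\<close> compensating blocks are used, each with at most
    \<open>B * B\<close> copies of either letter. The factor \<open>card T\<close> in the count
    below lets the pigeonhole principle find \<open>m\<close> positions with the same
    letter.\<close>
  define m where "m = K * nat (B * B)"
  have m0: "m > 0" using K B1 by (simp add: m_def)
  \<comment> \<open>With vertical movement at most \<open>6 * B\<^sup>2 * i\<close>, this separation
    uses \<open>384 * B^7 * i\<^sup>2\<close> in \<open>spread\<close>, half of the area bound
    \<open>768 * B^7 * i\<^sup>2\<close>; the other half absorbs the remaining terms for which
    \<open>large\<close> is assumed.\<close>
  define \<Delta> where "\<Delta> = 64 * B^5 * i"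
  have \<Delta>0: "\<Delta> \<ge> 0" using B1 i1 by (simp add: \<Delta>_def)
  have "\<exists>r. card T * m \<le> card {t\<in>{..<l}. qx (X t) > 0 \<and> R t \<ge> r}
      \<and> card T * m \<le> card {t\<in>{..<l}. qx (X t) < 0 \<and> R t \<le> r - \<Delta>}"
  proof (rule spread)
    have "(6 * B\<^sup>2 * i) * (\<Delta> + 1) = 384 * B^7 * i\<^sup>2 + 6 * B\<^sup>2 * i"
      by (simp add: \<Delta>_def eval_nat_numeral algebra_simps)
    moreover have "768 * B^7 * i\<^sup>2 - B * int l \<le> (\<Sum>t<l. qx (X t) * R t)"
      using area area_ge abs_sum_sx by linarith
    ultimately show "2 * int (card T * m) * (B * (2 * (B * int l) + 1)) + 6 * B\<^sup>2 * i * (\<Delta> + 1)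
        < (\<Sum>t<l. qx (X t) * R t)"
      using large by (simp add: m_def)
  qed (use sum_qx XT qB abs_R B1 \<Delta>0 sum_abs_qx in auto)
  then obtain r where r: "card T * m \<le> card {t\<in>{..<l}. qx (X t) > 0 \<and> R t \<ge> r}"
      "card T * m \<le> card {t\<in>{..<l}. qx (X t) < 0 \<and> R t \<le> r - \<Delta>}" by blast
  have Tne: "T \<noteq> {}" using bT by auto
  obtain y1 where y1: "y1 \<in> T" "m \<le> card {t\<in>{t\<in>{..<l}. qx (X t) > 0 \<and> R t \<ge> r}. X t = y1}"
    using pigeonhole_image[OF fin _ _ r(1), of X] m0 Tne XT by auto
  obtain y2 where y2: "y2 \<in> T" "m \<le> card {t\<in>{t\<in>{..<l}. qx (X t) < 0 \<and> R t \<le> r - \<Delta>}. X t = y2}"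
    using pigeonhole_image[OF fin _ _ r(2), of X] m0 Tne XT by auto
  obtain x1 where x1: "inj_on x1 {..<m}"
      "x1 ` {..<m} \<subseteq> {t\<in>{t\<in>{..<l}. qx (X t) > 0 \<and> R t \<ge> r}. X t = y1}"
    using card_le_inj_on[OF y1(2)] by blast
  obtain x2 where x2: "inj_on x2 {..<m}"
      "x2 ` {..<m} \<subseteq> {t\<in>{t\<in>{..<l}. qx (X t) < 0 \<and> R t \<le> r - \<Delta>}. X t = y2}"
    using card_le_inj_on[OF y2(2)] by blast
  have x1D: "x1 e < l" "R (x1 e) \<ge> r" "X (x1 e) = y1" "qx y1 > 0" if "e < m" for e
    using x1(2) that by auto
  have x2D: "x2 e < l" "R (x2 e) \<le> r - \<Delta>" "X (x2 e) = y2" "qx y2 < 0" if "e < m" for e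
    using x2(2) that by auto
  define \<beta>1 where "\<beta>1 = qx y1"
  define \<beta>2 where "\<beta>2 = - qx y2"
  have \<beta>: "1 \<le> \<beta>1" "1 \<le> \<beta>2" "\<beta>1 \<le> B" "\<beta>2 \<le> B"
    using x1D(4)[OF m0] x2D(4)[OF m0] qB[OF y1(1)] qB[OF y2(1)] by (auto simp: \<beta>1_def \<beta>2_def)
  \<comment> \<open>A block takes \<open>d1\<close> positions with letter \<open>y1\<close> and
    \<open>d2\<close> with letter \<open>y2\<close>. The vertical movements cancel, and the factor
    \<open>D\<close> makes the horizontal movement a multiple of \<open>D\<close>.\<close>
  define d1 where "d1 = nat (D * \<beta>2)"
  define d2 where "d2 = nat (D * \<beta>1)"
  have d: "int d1 = D * \<beta>2" "int d2 = D * \<beta>1" using D1 \<beta> by (auto simp: d1_def d2_def)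
  have dB: "D * \<beta>2 \<le> B * B" "D * \<beta>1 \<le> B * B" using D1 DB \<beta> by (auto intro!: mult_mono)
  then have dm: "\<nu> * d1 \<le> m" "\<nu> * d2 \<le> m" if "\<nu> \<le> K" for \<nu>
    using that by (auto simp: m_def d1_def d2_def intro!: mult_le_mono nat_mono)
  define A0 where "A0 = {t. t < l \<and> px (X t) = D}"
  have "4 * B\<^sup>2 * int K \<le> int (card A0)"
  proof -
    have "{..<l} = A0 \<union> {t. t < l \<and> px (X t) < D}" using XT pD by (fastforce simp: A0_def)
    then have "card {..<l} \<le> card A0 + card {t. t < l \<and> px (X t) < D}" by (metis card_Un_le)
    then have "int l \<le> int (card A0) + 6 * D * i" using card_nonmax by simp
    moreover have "D * i \<le> B^4 * i"
    proof (intro mult_right_mono)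
      have "B ^ 1 \<le> B ^ 4" using B1 by (intro power_increasing) auto
      then show "D \<le> B ^ 4" using DB by simp
    qed (use i1 in simp)
    moreover have "B\<^sup>2 * int K \<le> B^4 * i"
      using B1 iK by (intro mult_mono power_increasing) auto
    moreover have "0 \<le> B^4 * i" using B1 i1 by simp
    ultimately show ?thesis using long by linarith
  qed
  \<comment> \<open>The blocks can shift the endpoint by at most
    \<open>2 * B\<^sup>2 * int K\<close> units of \<open>D\<close>, so
    \<open>4 * B\<^sup>2 * int K\<close> horizontal letters guarantee
    \<open>int K \<le> k \<le> 6 * B\<^sup>2 * int K\<close>.\<close>
  then have "nat (4 * B\<^sup>2 * int K) \<le> card A0" by simp
  then obtain A where A: "A \<subseteq> A0" "card A = nat (4 * B\<^sup>2 * int K)" "finite A"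
    by (rule obtain_subset_with_card_n)
  have cA: "int (card A) = 4 * B\<^sup>2 * int K" using A B1 by simp
  have AD: "t < l" "px (X t) = D" "qx (X t) = 0" if "t \<in> A" for t
    using that A(1) XT qD by (auto simp: A0_def)
  define x where "x = sum lam A"
  have xb: "\<bar>x\<bar> \<le> int K * (28 * B^5 * i)"
  proof -
    have "\<bar>x\<bar> \<le> (\<Sum>t\<in>A. B + B * (6 * B\<^sup>2 * i))" unfolding x_def
    proof (rule order_trans[OF sum_abs], rule sum_mono)
      fix t assume t: "t \<in> A"
      have "\<bar>D * H t\<bar> \<le> B * (6 * B\<^sup>2 * i)"
        unfolding abs_mult using abs_H[of t] DB D1 B1 by (intro mult_mono) auto
      then show "\<bar>lam t\<bar> \<le> B + B * (6 * B\<^sup>2 * i)"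
        using sB[OF XT[OF AD(1)[OF t]]] by (simp add: lam_def AD[OF t])
    qed
    also have "\<dots> = 4 * B\<^sup>2 * int K * (B + B * (6 * B\<^sup>2 * i))" by (simp only: sum_constant cA of_nat_id)
    also have "\<dots> \<le> 4 * B\<^sup>2 * int K * (7 * B^3 * i)"
    proof (intro mult_left_mono)
      have "B ^ 1 * 1 \<le> B^3 * i" using B1 i1 by (intro mult_mono power_increasing) auto
      then show "B + B * (6 * B\<^sup>2 * i) \<le> 7 * B^3 * i"
        by (simp add: power2_eq_square power3_eq_cube algebra_simps)
    qed simp
    also have "\<dots> = int K * (28 * B^5 * i)" by (simp add: eval_nat_numeral)
    finally show ?thesis .
  qed
  define S1 where "S1 = (\<lambda>j. \<Sum>e<j. lam (x1 e))"
  define S2 where "S2 = (\<lambda>j. \<Sum>e<j. lam (x2 e))"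
  define f where "f = (\<lambda>j. S1 (j * d1) + S2 (j * d2))"
  define E where "E = B + B * (6 * B\<^sup>2 * i)"
  have E0: "0 \<le> E" using B1 i1 by (simp add: E_def)
  have pH: "\<bar>px (X t) * H t\<bar> \<le> B * (6 * B\<^sup>2 * i)" if "t < l" for t
    unfolding abs_mult using abs_H[of t] pB[OF XT[OF that]] B1 by (intro mult_mono) auto
  have lamE: "\<bar>lam t - qx (X t) * R t\<bar> \<le> E" if "t < l" for t
    using pH[OF that] sB[OF XT[OF that]] by (simp add: lam_def E_def)
  \<comment> \<open>In a block the terms containing \<open>r\<close> cancel between the rising and
    falling letters, leaving at least \<open>\<Delta>\<close> up to the contributions of
    \<open>H\<close> and \<open>sx\<close>, which are bounded by \<open>E\<close> per
    letter.\<close>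
  have steps: "f j + (\<Delta> - 2 * (B * B) * E) \<le> f (Suc j)" "f (Suc j) \<le> f j + 2 * (B * B) * (B * (B * int l) + E)"
    if j: "j < K" for j
  proof -
    have shift: "(\<Sum>e<Suc j * k. g e) = (\<Sum>e<j * k. g e) + (\<Sum>e<k. g (j * k + e))" for g :: "nat \<Rightarrow> int" and k
      using sum.atLeastLessThan_concat[of 0 "j * k" "Suc j * k" g] sum.shift_bounds_nat_ivl[of g 0 "j * k" k]
      by (simp add: atLeast0LessThan add.commute)
    have inc: "f (Suc j) = f j + (\<Sum>e<d1. lam (x1 (j * d1 + e))) + (\<Sum>e<d2. lam (x2 (j * d2 + e)))"
      by (simp only: f_def S1_def S2_def shift)
    have e1: "j * d1 + e < m" if "e < d1" for e using dm(1)[of "Suc j"] j that by simp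
    have e2: "j * d2 + e < m" if "e < d2" for e using dm(2)[of "Suc j"] j that by simp
    have lo1: "\<beta>1 * r - E \<le> lam (x1 e)" if e: "e < m" for e
    proof -
      have "\<beta>1 * r \<le> \<beta>1 * R (x1 e)" using x1D[OF e] \<beta> by (intro mult_left_mono) auto
      then show ?thesis using lamE[OF x1D(1)[OF e]] x1D(3)[OF e] by (simp add: \<beta>1_def)
    qed
    have lo2: "- \<beta>2 * (r - \<Delta>) - E \<le> lam (x2 e)" if e: "e < m" for e
    proof -
      have "\<beta>2 * R (x2 e) \<le> \<beta>2 * (r - \<Delta>)" using x2D[OF e] \<beta> by (intro mult_left_mono) auto
      then show ?thesis using lamE[OF x2D(1)[OF e]] x2D(3)[OF e] by (simp add: \<beta>2_def)
    qed
    have hi: "lam t \<le> B * (B * int l) + E" if t: "t < l" for t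
    proof -
      have "\<bar>qx (X t) * R t\<bar> \<le> B * (B * int l)"
        unfolding abs_mult using abs_R[of t] qB[OF XT[OF t]] B1 by (intro mult_mono) auto
      then show ?thesis using lamE[OF t] by linarith
    qed
    have "int d1 * (\<beta>1 * r - E) \<le> (\<Sum>e<d1. lam (x1 (j * d1 + e)))"
      using sum_mono[of "{..<d1}" "\<lambda>_. \<beta>1 * r - E" "\<lambda>e. lam (x1 (j * d1 + e))"] lo1 e1 by simp
    moreover have "int d2 * (- \<beta>2 * (r - \<Delta>) - E) \<le> (\<Sum>e<d2. lam (x2 (j * d2 + e)))"
      using sum_mono[of "{..<d2}" "\<lambda>_. - \<beta>2 * (r - \<Delta>) - E" "\<lambda>e. lam (x2 (j * d2 + e))"] lo2 e2 by simp
    moreover have "int d1 * (\<beta>1 * r - E) + int d2 * (- \<beta>2 * (r - \<Delta>) - E)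
        = (D * \<beta>1 * \<beta>2) * \<Delta> - (D * \<beta>2) * E - (D * \<beta>1) * E"
      by (simp add: d algebra_simps)
    moreover have "1 * \<Delta> \<le> (D * \<beta>1 * \<beta>2) * \<Delta>"
    proof (intro mult_right_mono \<Delta>0)
      have "1 * 1 * 1 \<le> D * \<beta>1 * \<beta>2" using D1 \<beta> by (intro mult_mono) auto
      then show "1 \<le> D * \<beta>1 * \<beta>2" by simp
    qed
    moreover have "(D * \<beta>2) * E \<le> (B * B) * E" "(D * \<beta>1) * E \<le> (B * B) * E"
      using dB E0 by (auto intro!: mult_right_mono)
    ultimately show "f j + (\<Delta> - 2 * (B * B) * E) \<le> f (Suc j)" using inc by (simp add: algebra_simps)
    let ?h = "B * (B * int l) + E"
    have h0: "0 \<le> ?h" using E0 B1 by simp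
    have "(\<Sum>e<d1. lam (x1 (j * d1 + e))) \<le> int d1 * ?h"
      using sum_mono[of "{..<d1}" "\<lambda>e. lam (x1 (j * d1 + e))" "\<lambda>_. ?h"] hi x1D(1) e1 by simp
    moreover have "(\<Sum>e<d2. lam (x2 (j * d2 + e))) \<le> int d2 * ?h"
      using sum_mono[of "{..<d2}" "\<lambda>e. lam (x2 (j * d2 + e))" "\<lambda>_. ?h"] hi x2D(1) e2 by simp
    moreover have "int d1 * ?h \<le> (B * B) * ?h" "int d2 * ?h \<le> (B * B) * ?h"
      using dB h0 d by (auto intro!: mult_right_mono)
    ultimately show "f (Suc j) \<le> f j + 2 * (B * B) * ?h" using inc by (simp add: algebra_simps)
  qed
  have E_le: "2 * (B * B) * E \<le> 14 * B^5 * i"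
  proof -
    have "B ^ 1 * 1 \<le> B^3 * i" using B1 i1 by (intro mult_mono power_increasing) auto
    then have "E \<le> 7 * (B^3 * i)" by (simp add: E_def power2_eq_square power3_eq_cube algebra_simps)
    then have "2 * (B * B) * E \<le> 2 * (B * B) * (7 * (B^3 * i))" using B1 by (intro mult_left_mono) auto
    then show ?thesis by (simp add: eval_nat_numeral algebra_simps)
  qed
  have i_le: "14 * B^5 * i \<le> 4 * B^5 * int l"
  proof -
    have "1 * i \<le> B^4 * i" using B1 i1 by (intro mult_right_mono) auto
    then have "14 * i \<le> 4 * int l" using long i1 by linarith
    then have "B^5 * (14 * i) \<le> B^5 * (4 * int l)" using B1 by (intro mult_left_mono) auto
    then show ?thesis by (simp add: algebra_simps)
  qed
  \<comment> \<open>Each block gains at least \<open>28 * B^5 * i\<close>, so \<open>K\<close>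
    blocks are enough to match \<open>x\<close>. The sign \<open>s\<close> decides whether the
    blocks are duplicated or deleted; the residue is at most one step, hence bounded independently
    of \<open>K\<close>.\<close>
  have "\<exists>\<nu>\<le>K. \<exists>s\<in>{1,-1}. \<bar>x + s * f \<nu>\<bar> \<le> 6 * B^5 * int l"
  proof (rule signed_partial_sum)
    show "f 0 = 0" by (simp add: f_def S1_def S2_def)
    show "f j + 28 * B^5 * i \<le> f (Suc j)" if "j < K" for j
    proof -
      have "0 \<le> B^5 * i" using B1 i1 by simp
      then show ?thesis using steps(1)[OF that] E_le unfolding \<Delta>_def by linarith
    qed
    show "f (Suc j) \<le> f j + 6 * B^5 * int l" if "j < K" for j
    proof -
      have "2 * (B * B) * (B * (B * int l)) = 2 * (B^4 * int l)" by (simp add: eval_nat_numeral)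
      also have "\<dots> \<le> 2 * (B^5 * int l)" using B1 by (intro mult_left_mono mult_right_mono power_increasing) auto
      finally show ?thesis using steps(2)[OF that] E_le i_le unfolding distrib_left by linarith
    qed
  qed (use xb B1 in auto)
  then obtain \<nu> s where \<nu>: "\<nu> \<le> K" "s \<in> {1,-1}" "\<bar>x + s * f \<nu>\<bar> \<le> 6 * B^5 * int l" by blast
  define V1 where "V1 = x1 ` {..<\<nu> * d1}"
  define V2 where "V2 = x2 ` {..<\<nu> * d2}"
  have inj: "inj_on x1 {..<\<nu> * d1}" "inj_on x2 {..<\<nu> * d2}"
    using x1(1) x2(1) dm[OF \<nu>(1)] by (auto intro: inj_on_subset)
  have y_sgn: "qx y1 > 0" "qx y2 < 0" using x1D(4) x2D(4) m0 by blast+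
  have VD: "t < l \<and> X t = y1 \<and> qx y1 > 0" if "t \<in> V1" for t
    using that x1D(1,3) y_sgn dm[OF \<nu>(1)] by (auto simp: V1_def)
  have VD2: "t < l \<and> X t = y2 \<and> qx y2 < 0" if "t \<in> V2" for t
    using that x2D(1,3) y_sgn dm[OF \<nu>(1)] by (auto simp: V2_def)
  have disj: "V1 \<inter> V2 = {}" "A \<inter> (V1 \<union> V2) = {}" using VD VD2 AD by fastforce+
  have sumV: "sum g (V1 \<union> V2) = (\<Sum>e<\<nu> * d1. g (x1 e)) + (\<Sum>e<\<nu> * d2. g (x2 e))" for g :: "nat \<Rightarrow> int"
    using disj(1) inj by (simp add: sum.union_disjoint V1_def V2_def sum.reindex)
  have sub: "A \<subseteq> {..<l}" "V1 \<union> V2 \<subseteq> {..<l}" using AD VD VD2 by auto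
  have fin2: "finite (V1 \<union> V2)" by (simp add: V1_def V2_def)
  define \<epsilon> where "\<epsilon> = sel A (V1 \<union> V2) s"
  have sumX: "(\<Sum>t<l. \<epsilon> t * g (X t)) = sum (\<lambda>t. g (X t)) A + s * (int \<nu> * (D * \<beta>2) * g y1 + int \<nu> * (D * \<beta>1) * g y2)"
    for g :: "tri \<Rightarrow> int"
  proof -
    have "(\<Sum>e<\<nu> * d1. g (X (x1 e))) = (\<Sum>e<\<nu> * d1. g y1)"
      using x1D(3) dm(1)[OF \<nu>(1)] by (intro sum.cong) auto
    moreover have "(\<Sum>e<\<nu> * d2. g (X (x2 e))) = (\<Sum>e<\<nu> * d2. g y2)"
      using x2D(3) dm(2)[OF \<nu>(1)] by (intro sum.cong) auto
    ultimately show ?thesis unfolding \<epsilon>_def sum_sel[OF sub] sumV by (simp add: d)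
  qed
  define k where "k = 4 * B\<^sup>2 * int K + s * (int \<nu> * (\<beta>2 * px y1 + \<beta>1 * px y2))"
  have kb: "\<bar>s * (int \<nu> * (\<beta>2 * px y1 + \<beta>1 * px y2))\<bar> \<le> 2 * B\<^sup>2 * int K"
  proof -
    have "\<bar>\<beta>2 * px y1\<bar> \<le> B * B" "\<bar>\<beta>1 * px y2\<bar> \<le> B * B"
      unfolding abs_mult using \<beta> pB[OF y1(1)] pB[OF y2(1)] by (auto intro!: mult_mono)
    then have "int \<nu> * \<bar>\<beta>2 * px y1 + \<beta>1 * px y2\<bar> \<le> int K * (2 * (B * B))"
      using \<nu>(1) by (intro mult_mono) auto
    moreover have "\<bar>s * (int \<nu> * (\<beta>2 * px y1 + \<beta>1 * px y2))\<bar> = int \<nu> * \<bar>\<beta>2 * px y1 + \<beta>1 * px y2\<bar>"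
      using \<nu>(2) by (auto simp: abs_mult)
    ultimately show ?thesis by (simp add: power2_eq_square algebra_simps)
  qed
  have KB: "int K \<le> B\<^sup>2 * int K" using mult_right_mono[of 1 "B\<^sup>2" "int K"] B1 by simp
  have "(\<Sum>t<l. \<bar>\<epsilon> t\<bar>) = (\<Sum>t<l. sel A (V1 \<union> V2) 1 t * 1)"
    using \<nu>(2) disj(2) by (intro sum.cong) (auto simp: \<epsilon>_def sel_def)
  also have "\<dots> = 4 * B\<^sup>2 * int K + (int \<nu> * (D * \<beta>2) + int \<nu> * (D * \<beta>1))"
    unfolding sum_sel[OF sub] sumV by (simp add: cA d)
  also have "\<dots> \<le> 4 * B\<^sup>2 * int K + (int K * (B * B) + int K * (B * B))"
    using dB \<nu>(1) D1 DB \<beta> by (intro add_mono mult_mono) auto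
  also have "\<dots> = 6 * B\<^sup>2 * int K" by (simp add: power2_eq_square algebra_simps)
  finally have abs\<epsilon>: "(\<Sum>t<l. \<bar>\<epsilon> t\<bar>) \<le> 6 * B\<^sup>2 * int K" .
  show ?thesis
  proof (intro exI conjI)
    show "\<forall>t<l. \<bar>\<epsilon> t\<bar> \<le> 1" using \<nu>(2) disj(2) by (auto simp: \<epsilon>_def sel_def)
    show "(\<Sum>t<l. \<bar>\<epsilon> t\<bar>) \<le> 6 * B\<^sup>2 * int K" by (rule abs\<epsilon>)
    show "(\<Sum>t<l. \<epsilon> t * qx (X t)) = 0"
      unfolding sumX using AD by (simp add: \<beta>1_def \<beta>2_def)
    have "sum (\<lambda>t. px (X t)) A = 4 * B\<^sup>2 * int K * D" using AD by (simp add: cA[symmetric])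
    then show "(\<Sum>t<l. \<epsilon> t * px (X t)) = k * D"
      unfolding sumX by (simp add: k_def algebra_simps)
    show "int K \<le> k" "k \<le> 6 * B\<^sup>2 * int K" using kb KB unfolding k_def by linarith+
    have "(\<Sum>t<l. \<epsilon> t * lam t) = x + s * f \<nu>"
      unfolding \<epsilon>_def sum_sel[OF sub] sumV by (simp add: x_def f_def S1_def S2_def)
    then show "\<bar>\<Sum>t<l. \<epsilon> t * lam t\<bar> \<le> 6 * B^5 * int l" using \<nu>(3) by simp
  qed
qed

end

section \<open>Second differences of the word length\<close>

context thin_word
begin

text \<open>The area is quadratic in the multiplicities \<open>1 + \<epsilon> t\<close>. Its linear
  part is the sum of \<open>\<epsilon> t * lam t\<close>; the quadratic part involves only pairs of
  modified letters and is therefore controlled by \<open>N\<close> instead of the length.\<close>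

lemma perturbed_word:
  fixes \<epsilon> :: "nat \<Rightarrow> int"
  assumes \<epsilon>: "\<And>t. t < l \<Longrightarrow> \<bar>\<epsilon> t\<bar> \<le> 1" and N: "(\<Sum>t<l. \<bar>\<epsilon> t\<bar>) \<le> N"
    and q0: "(\<Sum>t<l. \<epsilon> t * qx (X t)) = 0" and pk: "(\<Sum>t<l. \<epsilon> t * px (X t)) = k * D"
  obtains w s where "set w \<subseteq> T" "int (length w) = int l + (\<Sum>t<l. \<epsilon> t)"
    "sum_list w = Tri ((n + k) * D) 0 s"
    "\<bar>2 * D * qx b * (384 * B^7 * i) * i - s\<bar> \<le> \<bar>\<Sum>t<l. \<epsilon> t * lam t\<bar> + N\<^sup>2 * B\<^sup>2"
proof -
  let ?M = "2 * D * qx b * (384 * B^7 * i) * i"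
  define c where "c = (\<lambda>t. nat (1 + \<epsilon> t))"
  have c: "int (c t) = 1 + \<epsilon> t" if "t < l" for t using \<epsilon>[OF that] by (simp add: c_def)
  define w where "w = weighted_word c X l"
  let ?g = "\<lambda>u t. sg u t * omega (X u) (X t)"
  define F where "F = (\<Sum>t<l. \<Sum>u<l. \<epsilon> u * \<epsilon> t * ?g u t)"
  have sx0: "2 * ?M = 2 * (\<Sum>t<l. sx (X t)) + (\<Sum>t<l. \<Sum>u<l. ?g u t)"
    using weighted_word_value(3)[of "\<lambda>_. 1" X l] by (simp add: weighted_word_one[unfolded One_nat_def] val)
  have "2 * sx (sum_list w) = 2 * (\<Sum>t<l. (1 + \<epsilon> t) * sx (X t))
      + (\<Sum>t<l. \<Sum>u<l. (1 + \<epsilon> u) * (1 + \<epsilon> t) * ?g u t)"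
    unfolding w_def weighted_word_value by (simp add: c)
  also have "(\<Sum>t<l. \<Sum>u<l. (1 + \<epsilon> u) * (1 + \<epsilon> t) * ?g u t)
      = (\<Sum>t<l. \<Sum>u<l. ?g u t) + (\<Sum>t<l. \<Sum>u<l. \<epsilon> u * ?g u t) + (\<Sum>t<l. \<Sum>u<l. \<epsilon> t * ?g u t) + F"
    unfolding F_def sum.distrib[symmetric] by (intro sum.cong refl) (simp add: algebra_simps)
  \<comment> \<open>The two linear terms agree because the weight of a pair is symmetric.\<close>
  also have "(\<Sum>t<l. \<Sum>u<l. \<epsilon> u * ?g u t) = (\<Sum>u<l. \<Sum>t<l. \<epsilon> u * ?g u t)" by (rule sum.swap)
  also have "\<dots> = (\<Sum>t<l. \<Sum>u<l. \<epsilon> t * ?g u t)"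
    by (intro sum.cong refl) (simp add: sg_def omega_def)
  also have "(\<Sum>t<l. \<Sum>u<l. \<epsilon> t * ?g u t) = (\<Sum>t<l. \<epsilon> t * lam t) - (\<Sum>t<l. \<epsilon> t * sx (X t))"
    by (simp add: sum_distrib_left[symmetric] sum_sg_omega lam_def sum_subtractf[symmetric] algebra_simps)
  finally have sx: "2 * sx (sum_list w) = 2 * ?M + 2 * (\<Sum>t<l. \<epsilon> t * lam t) + F"
    using sx0 by (simp add: algebra_simps sum.distrib)
  have N0: "0 \<le> N" using N by (meson abs_ge_zero order_trans sum_nonneg)
  have "\<bar>F\<bar> \<le> (\<Sum>t<l. \<Sum>u<l. \<bar>\<epsilon> u\<bar> * \<bar>\<epsilon> t\<bar> * (2 * B\<^sup>2))"
    unfolding F_def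
  proof (intro order_trans[OF sum_abs] sum_mono)
    fix t u assume tu: "t \<in> {..<l}" "u \<in> {..<l}"
    have "\<bar>px (X u) * qx (X t)\<bar> \<le> B * B" "\<bar>qx (X u) * px (X t)\<bar> \<le> B * B"
      unfolding abs_mult using tu XT pB qB B1 by (auto intro!: mult_mono)
    then have "\<bar>omega (X u) (X t)\<bar> \<le> 2 * B\<^sup>2" unfolding omega_def by (simp add: power2_eq_square)
    then have "\<bar>?g u t\<bar> \<le> 1 * (2 * B\<^sup>2)"
      unfolding abs_mult by (intro mult_mono abs_sg_le) auto
    then have "\<bar>\<epsilon> u\<bar> * \<bar>\<epsilon> t\<bar> * \<bar>?g u t\<bar> \<le> \<bar>\<epsilon> u\<bar> * \<bar>\<epsilon> t\<bar> * (2 * B\<^sup>2)"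
      by (intro mult_left_mono) auto
    then show "\<bar>\<epsilon> u * \<epsilon> t * ?g u t\<bar> \<le> \<bar>\<epsilon> u\<bar> * \<bar>\<epsilon> t\<bar> * (2 * B\<^sup>2)"
      by (simp only: abs_mult)
  qed
  also have "\<dots> = (\<Sum>t<l. \<bar>\<epsilon> t\<bar>) * (\<Sum>t<l. \<bar>\<epsilon> t\<bar>) * (2 * B\<^sup>2)"
    by (simp add: sum_product sum_distrib_right sum_distrib_left mult_ac)
  also have "\<dots> \<le> N * N * (2 * B\<^sup>2)"
    using N N0 by (intro mult_right_mono mult_mono sum_nonneg) auto
  finally have F: "\<bar>F\<bar> \<le> 2 * (N\<^sup>2 * B\<^sup>2)" by (simp add: power2_eq_square mult_ac)
  show ?thesis
  proof
    show "set w \<subseteq> T" using set_weighted_word[of c X l] XT by (auto simp: w_def)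
    show "int (length w) = int l + (\<Sum>t<l. \<epsilon> t)"
      by (simp add: w_def length_weighted_word c sum.distrib)
    show "sum_list w = Tri ((n + k) * D) 0 (sx (sum_list w))"
    proof (rule tri.expand, intro conjI)
      show "px (sum_list w) = px (Tri ((n + k) * D) 0 (sx (sum_list w)))"
        by (simp add: w_def weighted_word_value c distrib_right sum.distrib pk sum_px)
      show "qx (sum_list w) = qx (Tri ((n + k) * D) 0 (sx (sum_list w)))"
        by (simp add: w_def weighted_word_value c distrib_right sum.distrib q0 sum_qx)
    qed simp
    show "\<bar>?M - sx (sum_list w)\<bar> \<le> \<bar>\<Sum>t<l. \<epsilon> t * lam t\<bar> + N\<^sup>2 * B\<^sup>2"
      using F sx by linarith
  qed
qed

text \<open>The perturbations \<open>\<epsilon>\<close> and \<open>- \<epsilon>\<close> move the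
  endpoint by opposite amounts, and their effects on the length cancel in the sum. Each area defect
  is linear in \<open>l\<close> with a constant independent of \<open>K\<close>, so
  \<open>fix_area\<close> repairs it with \<open>14 * B^5\<close> conjugating letters.\<close>

lemma second_difference:
  fixes K :: nat
  assumes large: "2 * int (card T * (K * nat (B * B))) * (B * (2 * (B * int l) + 1)) + B * int l + 6 * B\<^sup>2 * i
      < 384 * B^7 * i\<^sup>2"
    and iK: "int K \<le> i" "36 * B^6 * (int K)\<^sup>2 \<le> i"
  defines "M \<equiv> 2 * D * qx b * (384 * B^7 * i) * i"
  shows "\<exists>k. int K \<le> k \<and> k \<le> 6 * B\<^sup>2 * int K \<and>
    wlen T (Tri ((n + k) * D) 0 M) + wlen T (Tri ((n - k) * D) 0 M)
      \<le> 2 * l + 2 * (2 * nat (14 * B^5) + central_bound (4 * int (nat (14 * B^5)) * B\<^sup>2))"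
proof -
  obtain \<epsilon> k where \<epsilon>: "\<forall>t<l. \<bar>\<epsilon> t\<bar> \<le> 1" "(\<Sum>t<l. \<bar>\<epsilon> t\<bar>) \<le> 6 * B\<^sup>2 * int K"
      "(\<Sum>t<l. \<epsilon> t * qx (X t)) = 0" "(\<Sum>t<l. \<epsilon> t * px (X t)) = k * D"
      "\<bar>\<Sum>t<l. \<epsilon> t * lam t\<bar> \<le> 6 * B^5 * int l"
    and k: "int K \<le> k" "k \<le> 6 * B\<^sup>2 * int K"
    using perturbation[OF large iK(1)] by blast
  define r where "r = nat (14 * B^5)"
  have r: "int r = 14 * B^5" using B1 by (simp add: r_def)
  have B5: "1 \<le> B^5" "1 \<le> B^4" using B1 by simp_all
  have il: "96 * i \<le> int l"
    using long mult_right_mono[OF B5(2), of i] i1 by linarith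
  have "B\<^sup>2 * int K \<le> B^4 * i" using B1 iK by (intro mult_mono power_increasing) auto
  then have kl: "16 * k \<le> int l" using k long by linarith
  have bound: "int (wlen T (Tri ((n + j) * D) 0 M)) \<le> int l + (\<Sum>t<l. \<eta> t) + 2 * int r + int (central_bound (4 * int r * B\<^sup>2))"
    if \<eta>: "\<And>t. t < l \<Longrightarrow> \<bar>\<eta> t\<bar> \<le> 1" "(\<Sum>t<l. \<bar>\<eta> t\<bar>) \<le> 6 * B\<^sup>2 * int K"
      "(\<Sum>t<l. \<eta> t * qx (X t)) = 0" "(\<Sum>t<l. \<eta> t * px (X t)) = j * D"
      "\<bar>\<Sum>t<l. \<eta> t * lam t\<bar> \<le> 6 * B^5 * int l" and j: "\<bar>j\<bar> \<le> k"
    for \<eta> j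
  proof -
    obtain w s where w: "set w \<subseteq> T" "int (length w) = int l + (\<Sum>t<l. \<eta> t)"
        "sum_list w = Tri ((n + j) * D) 0 s"
        "\<bar>M - s\<bar> \<le> \<bar>\<Sum>t<l. \<eta> t * lam t\<bar> + (6 * B\<^sup>2 * int K)\<^sup>2 * B\<^sup>2"
      using perturbed_word[OF \<eta>(1-4)] unfolding M_def by blast
    \<comment> \<open>The second-order error is at most \<open>i\<close> by the second assumption in
      \<open>iK\<close>, and hence at most \<open>l\<close>.\<close>
    have "(6 * B\<^sup>2 * int K)\<^sup>2 * B\<^sup>2 = 36 * B^6 * (int K)\<^sup>2"
      by (simp add: power_mult_distrib eval_nat_numeral)
    then have "\<bar>M - s\<bar> \<le> 6 * B^5 * int l + int l" using w(4) \<eta>(5) iK(2) il i1 by linarith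
    also have "\<dots> \<le> 7 * B^5 * int l" using mult_right_mono[OF B5(1), of "int l"] by linarith
    also have "\<dots> \<le> 14 * B^5 * int l" using B1 by (intro mult_right_mono) auto
    finally have err: "\<bar>M - s\<bar> \<le> 14 * B^5 * int l" .
    \<comment> \<open>Both the excess \<open>6 * i\<close> and the shift \<open>k\<close> are at
      most a sixteenth of \<open>l\<close>, so the endpoint stays far enough to the right for
      \<open>fix_area\<close>.\<close>
    have nj: "int l \<le> 2 * (n + j)"
    proof -
      have "- k \<le> j" using j by linarith
      then show ?thesis using thin il kl i1 by (smt (verit))
    qed
    also have "\<dots> \<le> 2 * ((n + j) * D)" using nj D1 mult_left_mono[of 1 D "n + j"] by simp
    finally have P: "int l \<le> 2 * ((n + j) * D)" .
    have "14 * B^5 * int l \<le> 14 * B^5 * (2 * ((n + j) * D))" using P B1 by (intro mult_left_mono) auto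
    then have e: "\<bar>M - s\<bar> \<le> 2 * int r * ((n + j) * D)" using err r by (simp add: algebra_simps)
    have reach: "Tri ((n + j) * D) 0 M \<in> reach T"
    proof -
      have "0 \<le> 384 * B^7 * i" using B1 i1 by simp
      from area_reach[OF this, of "n + j" "nat i"] show ?thesis using i1 by (simp add: M_def)
    qed
    have "wlen T (Tri ((n + j) * D) 0 M) \<le> length w + 2 * r + central_bound (4 * int r * B\<^sup>2)"
      by (rule fix_area[OF w(1,3) _ e reach]) (use P in linarith)
    then show ?thesis using w(2) by linarith
  qed
  have "int (wlen T (Tri ((n + k) * D) 0 M)) \<le> int l + (\<Sum>t<l. \<epsilon> t) + 2 * int r + int (central_bound (4 * int r * B\<^sup>2))"
    by (rule bound) (use \<epsilon> k in auto)
  moreover have "int (wlen T (Tri ((n + - k) * D) 0 M)) \<le> int l + (\<Sum>t<l. - \<epsilon> t) + 2 * int r + int (central_bound (4 * int r * B\<^sup>2))"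
    by (rule bound) (use \<epsilon> k in \<open>auto simp: sum_negf\<close>)
  ultimately have "wlen T (Tri ((n + k) * D) 0 M) + wlen T (Tri ((n - k) * D) 0 M)
      \<le> 2 * l + 2 * (2 * r + central_bound (4 * int r * B\<^sup>2))"
    by (simp add: sum_negf)
  then show ?thesis using k unfolding r_def by blast
qed

end

section \<open>Minimizers of the tilted length\<close>

context heis_letters
begin

text \<open>The area of a rectangle of height \<open>i\<close> that is so wide that words
  which are nearly optimal at slope close to \<open>1\<close> have to be thin.\<close>

definition area_at :: "nat \<Rightarrow> int" where
  "area_at i = 2 * D * qx b * (384 * B^7 * int i) * int i"

definition target :: "nat \<Rightarrow> int \<Rightarrow> tri" where
  "target i n = Tri (n * D) 0 (area_at i)"

lemma target_add: "target i n + Tri (k * D) 0 0 = target i (n + k)"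
  by (auto simp: target_def algebra_simps intro!: tri.expand)

lemma target_reach: "target i n \<in> reach T"
  unfolding target_def area_at_def using B1 by (intro area_reach) simp

lemma abs_le_wlen:
  assumes "x \<in> reach T" "px x = n * D"
  shows "\<bar>n\<bar> \<le> int (wlen T x)"
proof -
  have "\<bar>n\<bar> * D \<le> int (wlen T x) * D" using abs_px_wlen[OF assms(1)] assms(2) D1 by (simp add: abs_mult)
  then show ?thesis using D1 by simp
qed

text \<open>A line of slope \<open>\<theta>\<close> supports the length function of the row from
  below and touches it at \<open>n\<close>.\<close>

definition minimizer :: "real \<Rightarrow> nat \<Rightarrow> int \<Rightarrow> bool" where
  "minimizer \<theta> i n \<longleftrightarrow> (\<forall>m. real (wlen T (target i n)) - \<theta> * n \<le> real (wlen T (target i m)) - \<theta> * m)"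

text \<open>The length is at least \<open>\<bar>n\<bar>\<close>, so the tilted length is bounded
  below by \<open>(1 - \<theta>) * \<bar>n\<bar>\<close> and only finitely many \<open>n\<close>
  compete with 0.\<close>

lemma ex_minimizer:
  assumes \<theta>: "0 \<le> \<theta>" "\<theta> < 1"
  shows "\<exists>n. minimizer \<theta> i n"
proof -
  define f where "f = (\<lambda>n. real (wlen T (target i n)) - \<theta> * n)"
  define A where "A = {n. f n \<le> f 0}"
  have lb: "(1 - \<theta>) * \<bar>real_of_int n\<bar> \<le> f n" for n
  proof -
    have "\<bar>real_of_int n\<bar> \<le> real (wlen T (target i n))"
      using abs_le_wlen[OF target_reach, of i n n] by (simp add: target_def)
    moreover have "\<theta> * n \<le> \<theta> * \<bar>real_of_int n\<bar>" using \<theta> by (intro mult_left_mono) auto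
    ultimately show ?thesis by (simp add: f_def algebra_simps)
  qed
  have "A \<subseteq> {- \<lceil>f 0 / (1 - \<theta>)\<rceil>..\<lceil>f 0 / (1 - \<theta>)\<rceil>}"
  proof
    fix n assume "n \<in> A"
    then have "(1 - \<theta>) * \<bar>real_of_int n\<bar> \<le> f 0" using lb[of n] by (simp add: A_def)
    then have "\<bar>real_of_int n\<bar> \<le> f 0 / (1 - \<theta>)" using \<theta> by (simp add: field_simps)
    then show "n \<in> {- \<lceil>f 0 / (1 - \<theta>)\<rceil>..\<lceil>f 0 / (1 - \<theta>)\<rceil>}" by (simp add: abs_le_iff) linarith
  qed
  then have fin: "finite A" by (rule finite_subset) simp
  have ne: "A \<noteq> {}" by (auto simp: A_def)
  obtain n where n: "n \<in> A" "\<And>m. m \<in> A \<Longrightarrow> f n \<le> f m"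
    using fin ne by (metis arg_min_if_finite(1,2) not_le)
  have "f n \<le> f m" for m
  proof (cases "m \<in> A")
    case False
    then show ?thesis using n(1) by (simp add: A_def)
  qed (use n in simp)
  then show ?thesis by (auto simp: minimizer_def f_def)
qed

text \<open>Comparing the minimizer with the rectangle of width \<open>384 * B^7 * i\<close> shows
  that its geodesics are thin and of length linear in \<open>i\<close>; for large \<open>i\<close>
  this brings \<open>second_difference\<close> into play. The order of quantifiers matters:
  \<open>C\<close> depends on neither \<open>K\<close> nor \<open>\<theta>\<close>.\<close>

lemma smooth_at_minimizer:
  "\<exists>C. \<forall>K \<theta>. 1 - 1 / (384 * real_of_int B^7) < \<theta> \<longrightarrow> \<theta> < 1 \<longrightarrow>
    (\<exists>I. \<forall>i\<ge>I. \<forall>n. minimizer \<theta> i n \<longrightarrow>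
      (\<exists>k. int K \<le> k \<and> k \<le> 6 * B\<^sup>2 * int K \<and>
        wlen T (target i (n + k)) + wlen T (target i (n - k)) \<le> 2 * wlen T (target i n) + C))"
proof (rule exI, intro allI impI, rule exI, intro allI impI)
  fix K :: nat and \<theta> :: real
  define N where "N = 384 * B^7"
  have N1: "N \<ge> 1" using one_le_power[OF B1, of 7] by (simp add: N_def)
  assume "1 - 1 / (384 * real_of_int B^7) < \<theta>" and \<theta>1: "\<theta> < 1"
  then have \<theta>N: "1 - 1 / real_of_int N < \<theta>" by (simp add: N_def)
  have "1 / real_of_int N \<le> 1" using N1 by simp
  then have \<theta>0: "0 < \<theta>" using \<theta>N by linarith
  define \<Lambda> where "\<Lambda> = \<lceil>3 / (1 - \<theta>)\<rceil>"
  have \<Lambda>: "3 / (1 - \<theta>) \<le> real_of_int \<Lambda>" by (simp add: \<Lambda>_def)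
  have "0 \<le> 3 / (1 - \<theta>)" using \<theta>1 by simp
  then have \<Lambda>0: "0 \<le> \<Lambda>" using \<Lambda> by linarith
  define m where "m = int (card T * (K * nat (B * B)))"
  \<comment> \<open>The left side of \<open>large\<close> grows at most like \<open>Z * i\<close>,
    while its right side is quadratic in \<open>i\<close>; thus \<open>i > Z\<close>
    suffices.\<close>
  define Z where "Z = 2 * m * (B * (2 * (B * \<Lambda>) + 1)) + B * \<Lambda> + 6 * B\<^sup>2"
  define I where "I = nat (Z + int K + 36 * B^6 * (int K)\<^sup>2 + 1)"
  fix i n assume i: "I \<le> i" and min: "minimizer \<theta> i n"
  have pos: "0 \<le> m" "0 \<le> Z" "0 \<le> 36 * B^6 * (int K)\<^sup>2"
    using B1 \<Lambda>0 by (auto simp: m_def Z_def)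
  have "Z + int K + 36 * B^6 * (int K)\<^sup>2 + 1 \<le> int i" using i unfolding I_def nat_le_iff .
  then have iI: "Z < int i" "int K \<le> int i" "36 * B^6 * (int K)\<^sup>2 \<le> int i" "1 \<le> int i"
    using pos by linarith+
  let ?g = "wlen T (target i n)"
  have gn: "\<bar>real_of_int n\<bar> \<le> real ?g"
    using abs_le_wlen[OF target_reach, of i n n] by (simp add: target_def)
  \<comment> \<open>The rectangle costs at most \<open>2 * i\<close> beyond its width, and the lower
    bound on \<open>\<theta>\<close> makes the tilted cost of the width at most
    \<open>i\<close>.\<close>
  have upper: "real ?g - \<theta> * n \<le> 3 * real i"
  proof -
    have "0 \<le> N * int i" using N1 by simp
    then have "int (wlen T (target i (N * int i))) \<le> N * int i + 2 * int i"
      using rectangle(2)[of "N * int i" i] by (simp add: target_def area_at_def N_def mult.assoc)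
    then have "real (wlen T (target i (N * int i))) \<le> real_of_int (N * int i + 2 * int i)"
      by (metis of_int_le_iff of_int_of_nat_eq)
    moreover have "real ?g - \<theta> * n \<le> real (wlen T (target i (N * int i))) - \<theta> * real_of_int (N * int i)"
      using min unfolding minimizer_def by (rule spec)
    moreover have "(1 - \<theta>) * real_of_int N * real i \<le> 1 * real i"
    proof (intro mult_right_mono)
      have "(1 - \<theta>) * real_of_int N \<le> (1 / real_of_int N) * real_of_int N"
        using \<theta>N N1 by (intro mult_right_mono) auto
      then show "(1 - \<theta>) * real_of_int N \<le> 1" using N1 by simp
    qed simp
    ultimately show ?thesis by (simp add: algebra_simps)
  qed
  \<comment> \<open>The 6 covers negative \<open>n\<close>, where the length and \<open>- n\<close>
    are each at most \<open>3 * i\<close>.\<close>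
  have thin: "int ?g - n \<le> 6 * int i"
  proof (cases "n \<ge> 0")
    case True
    then have "\<theta> * n \<le> 1 * real_of_int n" using \<theta>1 by (intro mult_right_mono) auto
    then have "real_of_int (int ?g - n) \<le> real_of_int (6 * int i)" using upper by simp
    then show ?thesis by linarith
  next
    case False
    then have "\<theta> * n \<le> 0" using \<theta>0 by (simp add: mult_nonneg_nonpos)
    then have "real_of_int (int ?g - n) \<le> real_of_int (6 * int i)" using upper gn by simp
    then show ?thesis by linarith
  qed
  have short: "int ?g \<le> \<Lambda> * int i"
  proof -
    have "\<theta> * n \<le> \<theta> * real ?g" using gn \<theta>0 by (intro mult_left_mono) auto
    then have "(1 - \<theta>) * real ?g \<le> 3 * real i" using upper by (simp add: algebra_simps)
    then have "real ?g \<le> 3 / (1 - \<theta>) * real i" using \<theta>1 by (simp add: field_simps)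
    also have "\<dots> \<le> real_of_int \<Lambda> * real i" using \<Lambda> by (intro mult_right_mono) auto
    finally have "real_of_int (int ?g) \<le> real_of_int (\<Lambda> * int i)" by simp
    then show ?thesis by linarith
  qed
  obtain ws where ws: "set ws \<subseteq> T" "sum_list ws = target i n" "length ws = ?g"
    using target_reach by (rule geodesic)
  interpret thin_word T D B b ws n "int i"
    by unfold_locales (use ws thin iI in \<open>auto simp: target_def area_at_def\<close>)
  have "2 * m * (B * (2 * (B * int ?g) + 1)) + B * int ?g + 6 * B\<^sup>2 * int i < 384 * B^7 * (int i)\<^sup>2"
  proof -
    have "2 * m * (B * (2 * (B * int ?g) + 1)) + B * int ?g + 6 * B\<^sup>2 * int i
        \<le> 2 * m * (B * (2 * (B * (\<Lambda> * int i)) + int i)) + B * (\<Lambda> * int i) + 6 * B\<^sup>2 * int i"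
      using short B1 pos iI by (intro add_mono mult_left_mono) auto
    also have "\<dots> = Z * int i" by (simp add: Z_def algebra_simps)
    also have "\<dots> < int i * int i" using iI by (intro mult_strict_right_mono) auto
    also have "\<dots> \<le> N * (int i * int i)" using N1 mult_right_mono[of 1 N "int i * int i"] by simp
    finally show ?thesis by (simp add: N_def power2_eq_square)
  qed
  then show "\<exists>k. int K \<le> k \<and> k \<le> 6 * B\<^sup>2 * int K \<and>
      wlen T (target i (n + k)) + wlen T (target i (n - k)) \<le> 2 * wlen T (target i n)
        + 2 * (2 * nat (14 * B^5) + central_bound (4 * int (nat (14 * B^5)) * B\<^sup>2))"
    using second_difference[of K] iI ws(3) by (simp add: target_def area_at_def m_def)
qed

end

section \<open>Cluster points and the cardinality of function spaces\<close>

text \<open>The closures of the tails of the sequence are nested and meet a compact box, so they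
  share a point of it. Neighbourhoods in the product restrict finitely many coordinates, which gives
  approximation on finite sets at arbitrarily late indices.\<close>

lemma product_cluster_point:
  fixes f :: "nat \<Rightarrow> 'a \<Rightarrow> real"
  assumes f: "\<And>i. f i \<in> PiE C (\<lambda>x. {- c x..c x})"
  shows "\<exists>h \<in> product_topology (\<lambda>_. euclideanreal) C closure_of (range f).
    \<forall>X j. finite X \<longrightarrow> X \<subseteq> C \<longrightarrow> (\<exists>i\<ge>j. \<forall>x\<in>X. \<bar>h x - f i x\<bar> < 1)"
proof -
  let ?Y = "product_topology (\<lambda>_. euclideanreal) C"
  define Q where "Q = PiE C (\<lambda>x. {- c x..c x})"
  define E where "E = (\<lambda>j. ?Y closure_of (f ` {j..}))"
  have Q: "compactin ?Y Q" by (auto simp: Q_def compactin_PiE)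
  have fQ: "f i \<in> Q" for i using f by (simp add: Q_def)
  have top: "topspace ?Y = PiE C (\<lambda>_. UNIV)" by simp
  have fE: "f i \<in> E j" if "j \<le> i" for i j
  proof -
    have "Q \<subseteq> topspace ?Y" unfolding top Q_def by (intro PiE_mono) simp
    then have "f ` {j..} \<subseteq> topspace ?Y" using fQ by blast
    then have "f ` {j..} \<subseteq> E j" unfolding E_def by (rule closure_of_subset)
    then show ?thesis using that by (simp add: subset_iff)
  qed
  have "\<forall>\<U>. (\<forall>C\<in>\<U>. closedin ?Y C) \<and> (\<forall>\<F>. finite \<F> \<and> \<F> \<subseteq> \<U> \<longrightarrow> Q \<inter> \<Inter>\<F> \<noteq> {}) \<longrightarrow> Q \<inter> \<Inter>\<U> \<noteq> {}"
    using Q unfolding compactin_fip by blast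
  moreover have "\<forall>C\<in>range E. closedin ?Y C" by (auto simp: E_def)
  moreover have "Q \<inter> \<Inter>\<F> \<noteq> {}" if \<F>: "finite \<F>" "\<F> \<subseteq> range E" for \<F>
  proof -
    obtain J where J: "finite J" "\<F> = E ` J" using \<F> by (meson finite_subset_image)
    define m where "m = Max (insert 0 J)"
    have "f m \<in> E j" if "j \<in> J" for j using that J by (intro fE) (simp add: m_def)
    then show ?thesis using fQ J by blast
  qed
  ultimately have "Q \<inter> \<Inter>(range E) \<noteq> {}" by blast
  then obtain h where h: "h \<in> Q" "\<And>j. h \<in> E j" by blast
  have "\<exists>i\<ge>j. \<forall>x\<in>X. \<bar>h x - f i x\<bar> < 1" if X: "finite X" "X \<subseteq> C" for X j
  proof -
    define U where "U = PiE C (\<lambda>x. if x \<in> X then ball (h x) 1 else UNIV)"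
    have "openin ?Y U" unfolding U_def openin_PiE_gen
      using X by (auto intro: finite_subset)
    moreover have "h \<in> U" using h(1) by (auto simp: U_def Q_def PiE_iff)
    ultimately obtain y where y: "y \<in> f ` {j..}" "y \<in> U"
      using h(2)[of j] unfolding E_def in_closure_of by blast
    then obtain i where i: "j \<le> i" "f i \<in> U" by auto
    have "\<bar>h x - f i x\<bar> < 1" if x: "x \<in> X" for x
    proof -
      have "f i x \<in> ball (h x) 1" using PiE_mem[OF i(2)[unfolded U_def], of x] x X(2) by auto
      then show ?thesis by (simp add: dist_real_def)
    qed
    then show ?thesis using i(1) by blast
  qed
  moreover have "h \<in> ?Y closure_of (range f)"
  proof -
    have "{0..} = (UNIV :: nat set)" by auto
    then show ?thesis using h(2)[of 0] by (simp add: E_def)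
  qed
  ultimately show ?thesis by blast
qed

text \<open>A function is encoded by the pairs of a point and a rational below its value there.
  Countability turns these pairs into natural numbers, and the density of the rationals makes the
  code injective.\<close>

lemma extensional_real_lepoll:
  assumes "countable C"
  shows "(PiE C (\<lambda>_. UNIV) :: ('a \<Rightarrow> real) set) \<lesssim> (UNIV :: real set)"
proof -
  define g :: "('a \<Rightarrow> real) \<Rightarrow> nat set"
    where "g = (\<lambda>h. {prod_encode (to_nat_on C x, m) | x m. x \<in> C \<and> real_of_rat (from_nat m) < h x})"
  have "inj_on g (PiE C (\<lambda>_. UNIV))"
  proof (rule inj_onI)
    fix h h' :: "'a \<Rightarrow> real" assume h: "h \<in> PiE C (\<lambda>_. UNIV)" "h' \<in> PiE C (\<lambda>_. UNIV)" and eq: "g h = g h'"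
    have mem: "prod_encode (to_nat_on C x, to_nat q) \<in> g k \<longleftrightarrow> real_of_rat q < k x" if "x \<in> C" for x q k
    proof
      assume "prod_encode (to_nat_on C x, to_nat q) \<in> g k"
      then obtain x' m where m: "prod_encode (to_nat_on C x, to_nat q) = prod_encode (to_nat_on C x', m)"
        "x' \<in> C" "real_of_rat (from_nat m) < k x'"
        unfolding g_def mem_Collect_eq by (elim exE conjE)
      have "to_nat_on C x = to_nat_on C x'" and mq: "m = to_nat q" using m(1) by (simp_all add: prod_encode_eq)
      then have "x = x'" using inj_onD[OF inj_on_to_nat_on[OF assms]] that m(2) by blast
      then show "real_of_rat q < k x" using m(3) mq by simp
    next
      assume "real_of_rat q < k x"
      then have "real_of_rat (from_nat (to_nat q)) < k x" by simp
      then show "prod_encode (to_nat_on C x, to_nat q) \<in> g k"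
        unfolding g_def mem_Collect_eq using that by (intro exI[of _ x] exI[of _ "to_nat q"] conjI) auto
    qed
    have le: "k x \<le> k' x" if "x \<in> C" "g k \<subseteq> g k'" for x k k'
    proof (rule ccontr)
      assume "\<not> k x \<le> k' x"
      then obtain q where "k' x < real_of_rat q" "real_of_rat q < k x" using of_rat_dense[of "k' x" "k x"] by (auto simp: not_le)
      then show False using mem[OF that(1), of q k] mem[OF that(1), of q k'] that(2) by auto
    qed
    have "h x = h' x" if "x \<in> C" for x using le[OF that] eq by (simp add: antisym)
    then show "h = h'" using h by (intro PiE_ext)
  qed
  then have "(PiE C (\<lambda>_. UNIV) :: ('a \<Rightarrow> real) set) \<lesssim> (UNIV :: nat set set)"
    unfolding lepoll_def by blast
  then show ?thesis using nat_sets_eqpoll_reals by (meson eqpoll_imp_lepoll lepoll_trans)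
qed

section \<open>Boundary points indexed by slopes\<close>

locale heis_word_metric = heis_letters + group G
  for G :: "('g, 'm) monoid_scheme" +
  fixes S :: "'g set" and \<phi> :: "'g \<Rightarrow> tri"
  assumes hom: "x \<in> carrier G \<Longrightarrow> y \<in> carrier G \<Longrightarrow> \<phi> (x \<otimes>\<^bsub>G\<^esub> y) = \<phi> x + \<phi> y"
    and inj: "inj_on \<phi> (carrier G)" and img: "\<phi> ` carrier G = reach T"
    and len: "x \<in> carrier G \<Longrightarrow> word_length G S x = wlen T (\<phi> x)"
begin

lemma \<phi>_one: "\<phi> \<one>\<^bsub>G\<^esub> = 0"
  using hom[of "\<one>\<^bsub>G\<^esub>" "\<one>\<^bsub>G\<^esub>"] by (metis add_0_right add_left_cancel one_closed r_one)

lemma \<phi>_inv: "x \<in> carrier G \<Longrightarrow> \<phi> (inv\<^bsub>G\<^esub> x) = - \<phi> x"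
  using hom[of "inv\<^bsub>G\<^esub> x" x] by (simp add: \<phi>_one eq_neg_iff_add_eq_0)

lemma \<phi>_reach: "x \<in> carrier G \<Longrightarrow> \<phi> x \<in> reach T"
  using img by blast

lemma horo_embedding_eq:
  assumes "g \<in> carrier G" "x \<in> carrier G"
  shows "horo_embedding G S g x = real (wlen T (- \<phi> g + \<phi> x)) - real (wlen T (- \<phi> g))"
  using assms by (simp add: horo_embedding_def word_metric_def len hom \<phi>_inv)

text \<open>Horofunctions are bounded pointwise by the word length of the argument, so those
  attached to minimizers have a cluster point. That it avoids the image of the group is shown only
  later.\<close>

lemma boundary_point_at_slope:
  fixes \<theta> :: real
  assumes \<theta>: "0 \<le> \<theta>" "\<theta> < 1"
  shows "\<exists>h \<in> product_topology (\<lambda>_. euclideanreal) (carrier G) closure_of (horo_embedding G S ` carrier G).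
    \<forall>L j. \<exists>i\<ge>j. \<exists>n. minimizer \<theta> i n \<and> (\<forall>x\<in>carrier G. \<forall>k. \<phi> x = Tri (k * D) 0 0 \<longrightarrow> \<bar>k\<bar> \<le> L
      \<longrightarrow> \<bar>h x - (real (wlen T (target i (n + k))) - real (wlen T (target i n)))\<bar> < 1)"
proof -
  obtain n where n: "\<And>i. minimizer \<theta> i (n i)" using ex_minimizer[OF \<theta>] by metis
  have "\<exists>g\<in>carrier G. \<phi> g = target i (n i)" for i using target_reach img by (metis imageE)
  then obtain g where g: "\<And>i. g i \<in> carrier G" "\<And>i. \<phi> (g i) = target i (n i)" by metis
  \<comment> \<open>Taking inverses turns the argument into a right factor of the target, so that
    powers of \<open>Tri D 0 0\<close> move along the row.\<close>
  define f where "f = (\<lambda>i. horo_embedding G S (inv\<^bsub>G\<^esub> (g i)))"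
  have f: "f i x = real (wlen T (target i (n i) + \<phi> x)) - real (wlen T (target i (n i)))"
    if "x \<in> carrier G" for i x
    using that g by (simp add: f_def horo_embedding_eq \<phi>_inv)
  have "f i \<in> PiE (carrier G) (\<lambda>x. {- real (wlen T (\<phi> x))..real (wlen T (\<phi> x))})" for i
  proof (rule PiE_I)
    fix x assume x: "x \<in> carrier G"
    let ?y = "target i (n i)"
    have "wlen T (?y + \<phi> x) \<le> wlen T ?y + wlen T (\<phi> x)"
      by (intro wlen_add target_reach \<phi>_reach x)
    moreover have "wlen T (?y + \<phi> x + - \<phi> x) \<le> wlen T (?y + \<phi> x) + wlen T (- \<phi> x)"
      by (intro wlen_add reach_add reach_uminus neg target_reach \<phi>_reach x)
    ultimately show "f i x \<in> {- real (wlen T (\<phi> x))..real (wlen T (\<phi> x))}"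
      using f[OF x] wlen_uminus[OF \<phi>_reach[OF x]] by (simp add: add.assoc)
  qed (simp add: f_def horo_embedding_def)
  from product_cluster_point[of f, OF this]
  obtain h where h: "h \<in> product_topology (\<lambda>_. euclideanreal) (carrier G) closure_of (range f)"
      "\<And>X j. finite X \<Longrightarrow> X \<subseteq> carrier G \<Longrightarrow> \<exists>i\<ge>j. \<forall>x\<in>X. \<bar>h x - f i x\<bar> < 1" by blast
  have "range f \<subseteq> horo_embedding G S ` carrier G" using g by (auto simp: f_def)
  then have "h \<in> product_topology (\<lambda>_. euclideanreal) (carrier G) closure_of (horo_embedding G S ` carrier G)"
    using h(1) closure_of_mono by blast
  moreover have "\<exists>i\<ge>j. \<exists>n. minimizer \<theta> i n \<and> (\<forall>x\<in>carrier G. \<forall>k. \<phi> x = Tri (k * D) 0 0 \<longrightarrow> \<bar>k\<bar> \<le> L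
      \<longrightarrow> \<bar>h x - (real (wlen T (target i (n + k))) - real (wlen T (target i n)))\<bar> < 1)" for L j
  proof -
    define X where "X = {x \<in> carrier G. \<exists>k. \<phi> x = Tri (k * D) 0 0 \<and> \<bar>k\<bar> \<le> L}"
    have "\<phi> ` X \<subseteq> (\<lambda>k. Tri (k * D) 0 0) ` {-L..L}" by (auto simp: X_def abs_le_iff image_iff)
    then have "finite (\<phi> ` X)" by (rule finite_subset) simp
    moreover have "inj_on \<phi> X" using inj by (rule inj_on_subset) (auto simp: X_def)
    ultimately have "finite X" by (rule finite_imageD)
    then obtain i where i: "i \<ge> j" "\<forall>x\<in>X. \<bar>h x - f i x\<bar> < 1"
      using h(2)[of X j] by (auto simp: X_def)
    have "\<bar>h x - (real (wlen T (target i (n i + k))) - real (wlen T (target i (n i))))\<bar> < 1"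
      if "x \<in> carrier G" "\<phi> x = Tri (k * D) 0 0" "\<bar>k\<bar> \<le> L" for x k
    proof -
      have "x \<in> X" using that by (auto simp: X_def)
      from bspec[OF i(2) this] show ?thesis using f[OF that(1), of i] that(2) by (simp add: target_add)
    qed
    then show ?thesis using i(1) n by blast
  qed
  ultimately show ?thesis by blast
qed

text \<open>The slope \<open>\<theta>\<close> of the limit horofunction along the powers of \<^term>\<open>Tri D 0 0\<close> can be read off,
  since the second difference of the length at a minimizer is bounded.\<close>

theorem interval_lepoll_boundary:
  "{1 - 1 / (384 * real_of_int B^7)<..<1} \<lesssim> horofunction_boundary G S"
proof -
  let ?I = "{1 - 1 / (384 * real_of_int B^7)<..<1}"
  let ?cl = "product_topology (\<lambda>_. euclideanreal) (carrier G) closure_of (horo_embedding G S ` carrier G)"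
  have "1 \<le> real_of_int B^7" using B1 by simp
  then have "1 / (384 * real_of_int B^7) \<le> 1" by (intro divide_le_eq_1_pos[THEN iffD2]) linarith+
  then have I0: "0 \<le> \<theta>" "\<theta> < 1" if "\<theta> \<in> ?I" for \<theta>
    using that by auto
  define P where "P = (\<lambda>\<theta> h. \<forall>L j. \<exists>i\<ge>j. \<exists>n. minimizer \<theta> i n \<and> (\<forall>x\<in>carrier G. \<forall>k. \<phi> x = Tri (k * D) 0 0 \<longrightarrow> \<bar>k\<bar> \<le> L
      \<longrightarrow> \<bar>h x - (real (wlen T (target i (n + k))) - real (wlen T (target i n)))\<bar> < 1))"
  have "\<forall>\<theta>\<in>?I. \<exists>h. h \<in> ?cl \<and> P \<theta> h"
  proof
    fix \<theta> assume "\<theta> \<in> ?I"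
    from boundary_point_at_slope[OF I0[OF this]] show "\<exists>h. h \<in> ?cl \<and> P \<theta> h"
      unfolding P_def Bex_def .
  qed
  from bchoice[OF this] obtain H where H': "\<forall>\<theta>\<in>?I. H \<theta> \<in> ?cl \<and> P \<theta> (H \<theta>)" ..
  have H: "H \<theta> \<in> ?cl" "P \<theta> (H \<theta>)" if "\<theta> \<in> ?I" for \<theta>
    using bspec[OF H' that] by (rule conjunct1, rule conjunct2)
  have "\<exists>x\<in>carrier G. \<phi> x = Tri (k * D) 0 0" for k using power_reach img by (metis imageE)
  then obtain a where a: "\<And>k. a k \<in> carrier G" "\<And>k. \<phi> (a k) = Tri (k * D) 0 0" by metis
  \<comment> \<open>The supporting line at the minimizer passes to the limit, with an error below
    1.\<close>
  have lower: "\<theta> * k - 1 \<le> H \<theta> (a k)" if \<theta>: "\<theta> \<in> ?I" for \<theta> k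
  proof -
    obtain i n where n: "minimizer \<theta> i n"
      "\<bar>H \<theta> (a k) - (real (wlen T (target i (n + k))) - real (wlen T (target i n)))\<bar> < 1"
      using H(2)[OF \<theta>, unfolded P_def, rule_format, of 0 "\<bar>k\<bar>"] a by blast
    have "real (wlen T (target i n)) - \<theta> * n \<le> real (wlen T (target i (n + k))) - \<theta> * (n + k)"
      using n(1) unfolding minimizer_def by (rule spec)
    then show ?thesis using n(2) by (simp add: algebra_simps)
  qed
  obtain C where C: "\<And>K \<theta>. \<theta> \<in> ?I \<Longrightarrow> \<exists>I. \<forall>i\<ge>I. \<forall>n. minimizer \<theta> i n \<longrightarrow>
      (\<exists>k. int K \<le> k \<and> k \<le> 6 * B\<^sup>2 * int K \<and>
        wlen T (target i (n + k)) + wlen T (target i (n - k)) \<le> 2 * wlen T (target i n) + C)"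
    using smooth_at_minimizer unfolding greaterThanLessThan_iff by blast
  have smooth: "\<exists>k. int K \<le> k \<and> H \<theta> (a k) + H \<theta> (a (- k)) \<le> real C + 2" if \<theta>: "\<theta> \<in> ?I" for \<theta> K
  proof -
    obtain I where I: "\<And>i n. i \<ge> I \<Longrightarrow> minimizer \<theta> i n \<Longrightarrow>
      \<exists>k. int K \<le> k \<and> k \<le> 6 * B\<^sup>2 * int K \<and>
        wlen T (target i (n + k)) + wlen T (target i (n - k)) \<le> 2 * wlen T (target i n) + C"
      using C[OF \<theta>, of K] by blast
    obtain i n where n: "i \<ge> I" "minimizer \<theta> i n"
      "\<And>k. \<bar>k\<bar> \<le> 6 * B\<^sup>2 * int K \<Longrightarrow>
        \<bar>H \<theta> (a k) - (real (wlen T (target i (n + k))) - real (wlen T (target i n)))\<bar> < 1"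
      using H(2)[OF \<theta>, unfolded P_def, rule_format, of I "6 * B\<^sup>2 * int K"] a by blast
    obtain k where k: "int K \<le> k" "k \<le> 6 * B\<^sup>2 * int K"
        "wlen T (target i (n + k)) + wlen T (target i (n - k)) \<le> 2 * wlen T (target i n) + C"
      using I[OF n(1,2)] by blast
    have "real (wlen T (target i (n + k))) + real (wlen T (target i (n - k))) \<le> 2 * real (wlen T (target i n)) + real C"
      using k(3) by linarith
    then show ?thesis using n(3)[of k] n(3)[of "- k"] k(1,2) by (intro exI[of _ k]) (simp add: abs_less_iff)
  qed
  have notin: "H \<theta> \<notin> horo_embedding G S ` carrier G" if \<theta>: "\<theta> \<in> ?I" for \<theta>
  proof
    assume "H \<theta> \<in> horo_embedding G S ` carrier G"
    then obtain g where g: "g \<in> carrier G" "H \<theta> = horo_embedding G S g" by blast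
    define y where "y = - \<phi> g"
    have y: "y \<in> reach T" using reach_uminus[OF neg \<phi>_reach[OF g(1)]] by (simp add: y_def)
    \<comment> \<open>The horofunction of a group element grows like \<open>\<bar>k\<bar>\<close> in
      both directions, which contradicts the bound in \<open>smooth\<close> for large
      \<open>k\<close>.\<close>
    have ge: "real_of_int \<bar>k\<bar> \<le> H \<theta> (a k) + 2 * real (wlen T y)" for k
    proof -
      let ?a = "Tri (k * D) 0 0"
      have "\<bar>k\<bar> \<le> int (wlen T (- y + (y + ?a)))"
        using abs_le_wlen[of ?a k] power_reach by (simp add: add.assoc[symmetric])
      also have "wlen T (- y + (y + ?a)) \<le> wlen T (- y) + wlen T (y + ?a)"
        by (intro wlen_add reach_add reach_uminus neg y power_reach)
      finally have "\<bar>k\<bar> \<le> int (wlen T y + wlen T (y + ?a))" using wlen_uminus[OF y] by simp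
      then have "real_of_int \<bar>k\<bar> \<le> real (wlen T y) + real (wlen T (y + ?a))" by linarith
      then show ?thesis using g a by (simp add: horo_embedding_eq y_def)
    qed
    obtain k where "int (C + 3 + 4 * wlen T y) \<le> k" "H \<theta> (a k) + H \<theta> (a (- k)) \<le> real C + 2"
      using smooth[OF \<theta>] by blast
    moreover have "real_of_int k \<le> real_of_int \<bar>k\<bar>" "real_of_int k \<le> real_of_int \<bar>- k\<bar>" by auto
    ultimately show False using ge[of k] ge[of "- k"] by linarith
  qed
  have "H ` ?I \<subseteq> horofunction_boundary G S"
    unfolding horofunction_boundary_def by (intro image_subsetI DiffI H(1) notin)
  moreover have "inj_on H ?I"
  proof (rule linorder_inj_onI)
    fix \<theta> \<theta>' assume lt: "\<theta> < \<theta>'" and in_I: "\<theta> \<in> ?I" "\<theta>' \<in> ?I"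
    show "H \<theta> \<noteq> H \<theta>'"
    proof
      assume eq: "H \<theta> = H \<theta>'"
      \<comment> \<open>For a common limit, the bound of slope \<open>\<theta>'\<close> at
        \<open>k\<close> and that of slope \<open>\<theta>\<close> at \<open>- k\<close> add up to
        \<open>(\<theta>' - \<theta>) * k - 2\<close>. This exceeds \<open>C + 2\<close> for
        \<open>k\<close> as large as chosen here.\<close>
      obtain K :: nat where K: "(real C + 4) / (\<theta>' - \<theta>) < real K" using reals_Archimedean2 by blast
      obtain k where k: "int K \<le> k" "H \<theta> (a k) + H \<theta> (a (- k)) \<le> real C + 2"
        using smooth[OF in_I(1)] by blast
      have "(real C + 4) / (\<theta>' - \<theta>) < real_of_int k" using K k(1) by linarith
      then have "real C + 4 < (\<theta>' - \<theta>) * k" using lt by (simp add: field_simps)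
      then have "real C + 4 < \<theta>' * k - \<theta> * k" by (simp add: left_diff_distrib)
      moreover have "\<theta> * real_of_int (- k) = - (\<theta> * k)" by simp
      ultimately show False
        using lower[OF in_I(2), of k] lower[OF in_I(1), of "- k"] k(2) unfolding eq by linarith
    qed
  qed auto
  ultimately show ?thesis unfolding lepoll_def by blast
qed

end

section \<open>Words in a group and their images under homomorphisms\<close>

lemma foldr_mult_append:
  assumes "group G" "set u \<subseteq> carrier G" "set v \<subseteq> carrier G"
  shows "foldr (mult G) (u @ v) \<one>\<^bsub>G\<^esub> = foldr (mult G) u \<one>\<^bsub>G\<^esub> \<otimes>\<^bsub>G\<^esub> foldr (mult G) v \<one>\<^bsub>G\<^esub>"
proof -
  interpret group G by fact
  have closed: "set w \<subseteq> carrier G \<Longrightarrow> foldr (mult G) w \<one>\<^bsub>G\<^esub> \<in> carrier G" for w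
    by (induction w) auto
  show ?thesis using assms(2,3) by (induction u) (auto simp: closed m_assoc)
qed

lemma generate_words:
  assumes "group G" and S: "symmetric_generating_set G S" and g: "g \<in> carrier G"
  shows "\<exists>ws. set ws \<subseteq> S \<and> foldr (mult G) ws \<one>\<^bsub>G\<^esub> = g"
proof -
  interpret group G by fact
  have SG: "S \<subseteq> carrier G" and inv: "\<And>s. s \<in> S \<Longrightarrow> inv\<^bsub>G\<^esub> s \<in> S" and gen: "generate G S = carrier G"
    using S by (auto simp: symmetric_generating_set_def)
  have "g \<in> generate G S" using g gen by simp
  then show ?thesis
  proof induction
    case one
    show ?case by (intro exI[of _ "[]"]) simp
  next
    case (incl h)
    then show ?case using SG by (intro exI[of _ "[h]"]) auto
  next
    case (inv h)
    then show ?case using SG \<open>\<And>s. s \<in> S \<Longrightarrow> inv\<^bsub>G\<^esub> s \<in> S\<close> by (intro exI[of _ "[inv\<^bsub>G\<^esub> h]"]) auto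
  next
    case (eng h1 h2)
    then obtain u v where "set u \<subseteq> S" "foldr (mult G) u \<one>\<^bsub>G\<^esub> = h1" "set v \<subseteq> S" "foldr (mult G) v \<one>\<^bsub>G\<^esub> = h2"
      by blast
    then show ?case using foldr_mult_append[OF assms(1), of u v] SG by (intro exI[of _ "u @ v"]) auto
  qed
qed

lemma hom_foldr_mult:
  fixes \<phi> :: "'g \<Rightarrow> 'h::group_add"
  assumes "group G" and hom: "\<And>x y. x \<in> carrier G \<Longrightarrow> y \<in> carrier G \<Longrightarrow> \<phi> (x \<otimes>\<^bsub>G\<^esub> y) = \<phi> x + \<phi> y"
    and ws: "set ws \<subseteq> carrier G"
  shows "foldr (mult G) ws \<one>\<^bsub>G\<^esub> \<in> carrier G \<and> \<phi> (foldr (mult G) ws \<one>\<^bsub>G\<^esub>) = sum_list (map \<phi> ws)"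
proof -
  interpret group G by fact
  have "\<phi> \<one>\<^bsub>G\<^esub> = 0"
    using hom[of "\<one>\<^bsub>G\<^esub>" "\<one>\<^bsub>G\<^esub>"] by (metis add_0_right add_left_cancel one_closed r_one)
  then show ?thesis using ws by (induction ws) (auto simp: hom)
qed

text \<open>Words over \<open>S\<close> and over its image correspond letter by letter; injectivity
  shows that a lifted word has the right value.\<close>

lemma word_length_eq_wlen:
  fixes \<phi> :: "'g \<Rightarrow> 'h::group_add"
  assumes "group G" and hom: "\<And>x y. x \<in> carrier G \<Longrightarrow> y \<in> carrier G \<Longrightarrow> \<phi> (x \<otimes>\<^bsub>G\<^esub> y) = \<phi> x + \<phi> y"
    and SG: "S \<subseteq> carrier G" and inj: "inj_on \<phi> (carrier G)" and g: "g \<in> carrier G"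
  shows "word_length G S g = wlen (\<phi> ` S) (\<phi> g)"
proof -
  have "(\<exists>ws. length ws = n \<and> set ws \<subseteq> S \<and> foldr (mult G) ws \<one>\<^bsub>G\<^esub> = g)
      \<longleftrightarrow> (\<exists>vs. length vs = n \<and> set vs \<subseteq> \<phi> ` S \<and> sum_list vs = \<phi> g)" (is "?l \<longleftrightarrow> ?r") for n
  proof
    assume ?l
    then obtain ws where "length ws = n" "set ws \<subseteq> S" "foldr (mult G) ws \<one>\<^bsub>G\<^esub> = g" by blast
    then show ?r using hom_foldr_mult[OF assms(1) hom, of ws] SG by (intro exI[of _ "map \<phi> ws"]) auto
  next
    assume ?r
    then obtain vs where vs: "length vs = n" "set vs \<subseteq> \<phi> ` S" "sum_list vs = \<phi> g" by blast
    then have "vs \<in> lists (\<phi> ` S)" by auto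
    then obtain ws where ws: "set ws \<subseteq> S" "vs = map \<phi> ws" unfolding lists_image by auto
    then have "foldr (mult G) ws \<one>\<^bsub>G\<^esub> \<in> carrier G" "\<phi> (foldr (mult G) ws \<one>\<^bsub>G\<^esub>) = \<phi> g"
      using hom_foldr_mult[OF assms(1) hom, of ws] SG vs(3) by auto
    then have "foldr (mult G) ws \<one>\<^bsub>G\<^esub> = g" using inj g by (auto dest: inj_onD)
    then show ?l using ws vs(1) by auto
  qed
  then show ?thesis by (simp add: word_length_def wlen_def)
qed

text \<open>Applied in contrapositive form: a homomorphism that is nonzero somewhere is nonzero at a
  generator, which supplies letters in prescribed directions.\<close>

lemma hom_vanishing_on_generators:
  fixes f :: "'g \<Rightarrow> int"
  assumes "group G" "symmetric_generating_set G S"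
    and hom: "\<And>x y. x \<in> carrier G \<Longrightarrow> y \<in> carrier G \<Longrightarrow> f (x \<otimes>\<^bsub>G\<^esub> y) = f x + f y"
    and 0: "\<And>s. s \<in> S \<Longrightarrow> f s = 0" and g: "g \<in> carrier G"
  shows "f g = 0"
proof -
  obtain ws where ws: "set ws \<subseteq> S" "foldr (mult G) ws \<one>\<^bsub>G\<^esub> = g"
    using generate_words[OF assms(1,2) g] by blast
  have "f g = sum_list (map f ws)"
    using hom_foldr_mult[OF assms(1) hom, of ws] ws assms(2) by (auto simp: symmetric_generating_set_def)
  also have "map f ws = map (\<lambda>_. 0) ws" using ws(1) 0 by auto
  also have "sum_list (map (\<lambda>_. 0) ws) = (0 :: int)" by simp
  finally show ?thesis .
qed

section \<open>Integer matrices in coordinates adapted to a letter\<close>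

definition unip :: "int \<Rightarrow> int \<Rightarrow> int \<Rightarrow> int^3^3" where
  "unip x y z = vector [vector [1, x, z], vector [0, 1, y], vector [0, 0, 1]]"

lemma unip_carrier: "unip x y z \<in> carrier heisenberg"
  by (simp add: unip_def heisenberg_def)

lemma unip_entries [simp]: "unip x y z $ 1 $ 2 = x" "unip x y z $ 2 $ 3 = y" "unip x y z $ 1 $ 3 = z"
  by (simp_all add: unip_def)

lemma heisenberg_mult_entries:
  assumes "A \<in> carrier heisenberg" "B \<in> carrier heisenberg"
  shows "(A \<otimes>\<^bsub>heisenberg\<^esub> B) $ 1 $ 2 = A $ 1 $ 2 + B $ 1 $ 2"
    and "(A \<otimes>\<^bsub>heisenberg\<^esub> B) $ 2 $ 3 = A $ 2 $ 3 + B $ 2 $ 3"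
    and "(A \<otimes>\<^bsub>heisenberg\<^esub> B) $ 1 $ 3 = A $ 1 $ 3 + B $ 1 $ 3 + A $ 1 $ 2 * B $ 2 $ 3"
  using assms by (simp_all add: heisenberg_def matrix_matrix_mult_def sum_3)

lemma heisenberg_eqI:
  assumes "A \<in> carrier heisenberg" "B \<in> carrier heisenberg"
    and "A $ 1 $ 2 = B $ 1 $ 2" "A $ 2 $ 3 = B $ 2 $ 3" "A $ 1 $ 3 = B $ 1 $ 3"
  shows "A = B"
  using assms by (simp add: heisenberg_def vec_eq_iff forall_3)

lemma countable_heisenberg: "countable (carrier heisenberg)"
proof (rule countable_image_inj_on)
  let ?f = "\<lambda>A :: int^3^3. (A $ 1 $ 2, A $ 2 $ 3, A $ 1 $ 3)"
  show "countable (?f ` carrier heisenberg)" by (rule countableI_type)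
  show "inj_on ?f (carrier heisenberg)" by (auto intro!: inj_onI heisenberg_eqI)
qed

text \<open>Coordinates adapted to a matrix \<open>a\<close>: the first two are multiples of the components of the
  abelianization along and across \<open>a\<close>; the third is the symmetrized central
  coordinate, rescaled and sheared so that it vanishes at \<open>a\<close>.\<close>

definition symm_area :: "int^3^3 \<Rightarrow> int" where
  "symm_area A = 2 * A $ 1 $ 3 - A $ 1 $ 2 * A $ 2 $ 3"

definition sqnorm :: "int^3^3 \<Rightarrow> int" where
  "sqnorm A = (A $ 1 $ 2)\<^sup>2 + (A $ 2 $ 3)\<^sup>2"

definition inner2 :: "int^3^3 \<Rightarrow> int^3^3 \<Rightarrow> int" where
  "inner2 a A = a $ 1 $ 2 * A $ 1 $ 2 + a $ 2 $ 3 * A $ 2 $ 3"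

definition cross2 :: "int^3^3 \<Rightarrow> int^3^3 \<Rightarrow> int" where
  "cross2 a A = a $ 1 $ 2 * A $ 2 $ 3 - a $ 2 $ 3 * A $ 1 $ 2"

definition coords :: "int^3^3 \<Rightarrow> int^3^3 \<Rightarrow> tri" where
  "coords a A = Tri (sqnorm a * inner2 a A) (cross2 a A)
     (sqnorm a * (sqnorm a * symm_area A - symm_area a * inner2 a A))"

lemma coords_self: "coords a a = Tri (sqnorm a * sqnorm a) 0 0"
  by (simp add: coords_def inner2_def cross2_def sqnorm_def power2_eq_square mult.commute)

text \<open>Passing to \<open>inner2\<close> and \<open>cross2\<close> multiplies determinants by
  \<open>sqnorm a\<close>. With the extra factor in the first coordinate, \<open>omega\<close>
  scales by the square of \<open>sqnorm a\<close>, matching the factor of \<open>symm_area\<close>;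
  the shear is additive and does no harm.\<close>

lemma coords_hom:
  assumes "A \<in> carrier heisenberg" "B \<in> carrier heisenberg"
  shows "coords a (A \<otimes>\<^bsub>heisenberg\<^esub> B) = coords a A + coords a B"
  by (rule tri.expand)
    (auto simp: coords_def heisenberg_mult_entries[OF assms] inner2_def cross2_def sqnorm_def symm_area_def
      power2_eq_square algebra_simps)

lemma coords_inj:
  assumes a: "sqnorm a > 0"
  shows "inj_on (coords a) (carrier heisenberg)"
proof (rule inj_onI)
  fix A B assume AB: "A \<in> carrier heisenberg" "B \<in> carrier heisenberg" and eq: "coords a A = coords a B"
  have i: "inner2 a A = inner2 a B" and c: "cross2 a A = cross2 a B" and s: "symm_area A = symm_area B"
    using eq a by (auto simp: coords_def)
  have x: "sqnorm a * C $ 1 $ 2 = a $ 1 $ 2 * inner2 a C - a $ 2 $ 3 * cross2 a C"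
    and y: "sqnorm a * C $ 2 $ 3 = a $ 2 $ 3 * inner2 a C + a $ 1 $ 2 * cross2 a C" for C
    by (simp_all add: sqnorm_def inner2_def cross2_def power2_eq_square algebra_simps)
  have "sqnorm a * A $ 1 $ 2 = sqnorm a * B $ 1 $ 2" "sqnorm a * A $ 2 $ 3 = sqnorm a * B $ 2 $ 3"
    by (simp_all only: x y i c)
  then have "A $ 1 $ 2 = B $ 1 $ 2" "A $ 2 $ 3 = B $ 2 $ 3" using a by simp_all
  then show "A = B" using s by (intro heisenberg_eqI AB) (auto simp: symm_area_def)
qed

text \<open>Expand the squared distance between the two abelianized vectors. Equality forces the
  vectors to coincide, which is why a letter of maximal Euclidean norm is the right choice.\<close>

lemma inner2_le:
  assumes "sqnorm A \<le> sqnorm a"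
  shows "inner2 a A \<le> sqnorm a" and "inner2 a A = sqnorm a \<Longrightarrow> cross2 a A = 0"
proof -
  let ?x = "A $ 1 $ 2 - a $ 1 $ 2" and ?y = "A $ 2 $ 3 - a $ 2 $ 3"
  have eq: "?x\<^sup>2 + ?y\<^sup>2 = sqnorm A + sqnorm a - 2 * inner2 a A"
    by (simp add: sqnorm_def inner2_def power2_eq_square algebra_simps)
  have "0 \<le> ?x\<^sup>2 + ?y\<^sup>2" by simp
  then show "inner2 a A \<le> sqnorm a" using eq assms by linarith
  assume "inner2 a A = sqnorm a"
  then have "?x\<^sup>2 + ?y\<^sup>2 \<le> 0" using eq assms by linarith
  then have "?x = 0 \<and> ?y = 0" by (simp only: sum_power2_le_zero_iff)
  then show "cross2 a A = 0" by (simp add: cross2_def)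
qed

lemma horofunction_boundary_lepoll:
  assumes "countable (carrier G)"
  shows "horofunction_boundary G S \<lesssim> (UNIV :: real set)"
proof -
  have "horofunction_boundary G S \<subseteq> PiE (carrier G) (\<lambda>_. UNIV)"
    using closure_of_subset_topspace[of "product_topology (\<lambda>_. euclideanreal) (carrier G)"]
    by (auto simp: horofunction_boundary_def)
  then show ?thesis
    using extensional_real_lepoll[OF assms] by (meson lepoll_trans subset_imp_lepoll)
qed

lemma heisenberg_boundary_ge:
  assumes fin: "finite S" and gen: "symmetric_generating_set heisenberg S"
  shows "(UNIV :: real set) \<lesssim> horofunction_boundary heisenberg S"
proof -
  interpret H: group heisenberg by (rule group_heisenberg)
  have SH: "S \<subseteq> carrier heisenberg" and S_inv: "\<And>s. s \<in> S \<Longrightarrow> inv\<^bsub>heisenberg\<^esub> s \<in> S"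
    using gen by (auto simp: symmetric_generating_set_def)
  have vanish: "f g = 0" if "\<And>A B. A \<in> carrier heisenberg \<Longrightarrow> B \<in> carrier heisenberg \<Longrightarrow> f (A \<otimes>\<^bsub>heisenberg\<^esub> B) = f A + f B"
    "\<And>s. s \<in> S \<Longrightarrow> f s = 0" "g \<in> carrier heisenberg" for f :: "int^3^3 \<Rightarrow> int" and g
    using hom_vanishing_on_generators[OF group_heisenberg gen, of f g] that by blast
  \<comment> \<open>Some generator has nonzero abelianization, so the maximal norm is
    positive.\<close>
  obtain s0 where s0: "s0 \<in> S" "s0 $ 1 $ 2 \<noteq> 0"
    using vanish[of "\<lambda>A. A $ 1 $ 2" "unip 1 0 0"] unip_carrier by (auto simp: heisenberg_mult_entries)
  have "Max (sqnorm ` S) \<in> sqnorm ` S" using s0 fin by (intro Max_in) auto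
  then obtain a where a: "a \<in> S" "sqnorm a = Max (sqnorm ` S)" by auto
  have a_max: "sqnorm s \<le> sqnorm a" if "s \<in> S" for s using that fin by (simp add: a(2))
  have "0 < sqnorm s0" using s0 by (simp add: sqnorm_def sum_power2_gt_zero_iff)
  then have a0: "0 < sqnorm a" using a_max[OF s0(1)] by linarith
  define \<phi> where "\<phi> = coords a"
  define T where "T = \<phi> ` S"
  define D where "D = sqnorm a * sqnorm a"
  have hom: "\<phi> (A \<otimes>\<^bsub>heisenberg\<^esub> B) = \<phi> A + \<phi> B" if "A \<in> carrier heisenberg" "B \<in> carrier heisenberg" for A B
    using that by (simp add: \<phi>_def coords_hom)
  have inj: "inj_on \<phi> (carrier heisenberg)" using a0 by (simp add: \<phi>_def coords_inj)
  have one: "\<phi> \<one>\<^bsub>heisenberg\<^esub> = 0"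
    using hom[of "\<one>\<^bsub>heisenberg\<^esub>" "\<one>\<^bsub>heisenberg\<^esub>"] by (metis H.one_closed H.r_one add_0_right add_left_cancel)
  have neg: "- x \<in> T" if x: "x \<in> T" for x
  proof -
    obtain s where s: "s \<in> S" "x = \<phi> s" using x by (auto simp: T_def)
    then have "\<phi> (inv\<^bsub>heisenberg\<^esub> s) + \<phi> s = 0"
      using hom[of "inv\<^bsub>heisenberg\<^esub> s" s] SH one by auto
    then have "- x = \<phi> (inv\<^bsub>heisenberg\<^esub> s)" using s by (simp add: eq_neg_iff_add_eq_0[symmetric])
    then show ?thesis using s S_inv by (simp add: T_def)
  qed
  obtain s1 where s1: "s1 \<in> S" "cross2 a s1 \<noteq> 0"
  proof -
    \<comment> \<open>The abelianization of \<open>a\<close> rotated by a right angle witnesses that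
      \<open>cross2 a\<close> does not vanish on the group, hence not on \<open>S\<close>.\<close>
    have "cross2 a (unip (- a $ 2 $ 3) (a $ 1 $ 2) 0) = sqnorm a"
      by (simp add: cross2_def sqnorm_def power2_eq_square)
    moreover have "cross2 a (A \<otimes>\<^bsub>heisenberg\<^esub> B) = cross2 a A + cross2 a B"
      if "A \<in> carrier heisenberg" "B \<in> carrier heisenberg" for A B
      using that by (simp add: cross2_def heisenberg_mult_entries algebra_simps)
    ultimately show ?thesis using vanish[of "cross2 a"] that unip_carrier a0 by (metis less_irrefl)
  qed
  have s1T: "\<phi> s1 \<in> T" using s1 by (simp add: T_def)
  obtain b where b: "b \<in> T" "1 \<le> qx b"
  proof (cases "cross2 a s1 > 0")
    case True
    then show ?thesis using that[OF s1T] by (simp add: \<phi>_def coords_def)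
  next
    case False
    then show ?thesis using that[OF neg[OF s1T]] s1 by (simp add: \<phi>_def coords_def)
  qed
  define B where "B = D + (\<Sum>x\<in>T. \<bar>px x\<bar> + \<bar>qx x\<bar> + \<bar>sx x\<bar>)"
  have finT: "finite T" using fin by (simp add: T_def)
  have D1: "1 \<le> D" using mult_pos_pos[OF a0 a0] by (simp add: D_def)
  have B: "\<bar>px x\<bar> + \<bar>qx x\<bar> + \<bar>sx x\<bar> \<le> B" if "x \<in> T" for x
    using member_le_sum[OF that, of "\<lambda>x. \<bar>px x\<bar> + \<bar>qx x\<bar> + \<bar>sx x\<bar>"] finT D1 by (simp add: B_def)
  have img: "\<phi> ` carrier heisenberg = reach T"
  proof (intro equalityI subsetI)
    fix x assume "x \<in> \<phi> ` carrier heisenberg"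
    then obtain ws where ws: "set ws \<subseteq> S" "x = \<phi> (foldr (mult heisenberg) ws \<one>\<^bsub>heisenberg\<^esub>)"
      using generate_words[OF group_heisenberg gen] by blast
    then have "x = sum_list (map \<phi> ws)" using hom_foldr_mult[OF group_heisenberg hom, of ws] SH by auto
    then show "x \<in> reach T" using ws reachI[of "map \<phi> ws" T] by (auto simp: T_def)
  next
    fix x assume "x \<in> reach T"
    then obtain vs where "vs \<in> lists (\<phi> ` S)" "x = sum_list vs" by (auto simp: reach_def T_def)
    then obtain ws where "set ws \<subseteq> S" "x = sum_list (map \<phi> ws)" unfolding lists_image by auto
    then show "x \<in> \<phi> ` carrier heisenberg"
      using hom_foldr_mult[OF group_heisenberg hom, of ws] SH by (metis image_eqI order_trans)
  qed
  interpret heis_word_metric T D B b heisenberg S \<phi>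
  proof unfold_locales
    show "Tri D 0 0 \<in> T" using a(1) by (auto simp: T_def \<phi>_def D_def coords_self[symmetric])
    show "px x \<le> D" if "x \<in> T" for x
      using that inner2_le(1)[OF a_max] a0 by (auto simp: T_def \<phi>_def coords_def D_def)
    show "qx x = 0" if "x \<in> T" "px x = D" for x
      using that inner2_le(2)[OF a_max] a0 by (auto simp: T_def \<phi>_def coords_def D_def)
    show "D \<le> B" by (simp add: B_def sum_nonneg)
    show "\<bar>px x\<bar> \<le> B" "\<bar>qx x\<bar> \<le> B" "\<bar>sx x\<bar> \<le> B" if "x \<in> T" for x using B[OF that] by linarith+
    show "word_length heisenberg S x = wlen T (\<phi> x)" if "x \<in> carrier heisenberg" for x
      unfolding T_def by (rule word_length_eq_wlen[OF group_heisenberg hom SH inj that])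
  qed (fact finT neg D1 b hom inj img)+
  let ?I = "{1 - 1 / (384 * real_of_int B^7)<..<1}"
  have "0 < real_of_int B" using B1 by simp
  then have "?I \<approx> (UNIV :: real set)" by (simp add: open_interval_eqpoll_reals)
  then show ?thesis using interval_lepoll_boundary by (meson eqpoll_imp_lepoll eqpoll_sym lepoll_trans)
qed

theorem theoremB:
  fixes S :: "(int^3^3) set"
  assumes "finite S"
    and "symmetric_generating_set heisenberg S"
  shows "horofunction_boundary heisenberg S \<approx> (UNIV :: real set)"
  using horofunction_boundary_lepoll[OF countable_heisenberg] heisenberg_boundary_ge[OF assms]
  by (rule lepoll_antisym)

end
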